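(* Let $X$ be a graphite. Then $\mathcal{T}(X)$ contains a dense $G_\delta$ subset of $\mathcal{S}(X)$.
   Context: For a compact metric space $(X,d)$, $\mathcal{C}(X)$ is the space of all continuous maps $f:X\to X$ with the metric $\rho(f,g)=\max_{x\in X}d(f(x),g(x))$, and $\mathcal{S}(X)\subseteq\mathcal{C}(X)$ is the subspace of surjective maps. For a continuous map $f:X\to X$ and $\delta>0$, a $\delta$-pseudo-orbit for $f$ is a sequence $\langle x_i\rangle_{i\in\omega}$ in $X$ with $d(x_{i+1},f(x_i))<\delta$ for all $i\in\omega$. The map $f$ has shadowing if for every $\epsilon>0$ there exists $\delta>0$ such that for each $\delta$-pseudo-orbit $\langle x_i\rangle_{i\in\omega}$ for $f$ there exists $z\in X$ with $d(x_i,f^i(z))<\epsilon$ for all $i\in\omega$. $\mathcal{T}(X)$ is the subset of $\mathcal{C}(X)$ consisting of the maps with shadowing. A graph is a compact connected metric space $G$ for which there is a finite collection of arcs $A_1,\dots,A_n$ with $G=\bigcup_i A_i$ such that for $i\ne j$, $A_i\cap A_j$ is a subset of the endpoints of $A_i$ (and also of $A_j$). A graphoid is a compact metric space $X$ such that for every $\epsilon>0$ there exist a graph $G\subseteq X$ and a (continuous) retraction $\pi_G:X\to G$ that is an $\epsilon$-map, i.e. $\pi_G^{-1}(x)$ has diameter less than $\epsilon$ for each $x\in G$. A graphite is a locally connected graphoid. *)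

theory Defs
  imports "HOL-Analysis.Analysis"
begin

text \<open>
  Compact metric spaces are rendered as compact subsets \<open>X\<close> of an arbitrary type of class
  \<^class>\<open>metric_space\<close>, carrying the restricted metric.
\<close>

section \<open>The function spaces\<close>

text \<open>
  Self-maps of \<open>X\<close> are represented by functions that are \<^const>\<open>undefined\<close> outside \<open>X\<close> (the
  convention of \<^const>\<open>cfunspace\<close>), so that distinct members differ at a point of \<open>X\<close>.
\<close>

definition cspace :: "'a::metric_space set \<Rightarrow> ('a \<Rightarrow> 'a) metric"
  where "cspace X = cfunspace (top_of_set X) (submetric euclidean_metric X)"

definition sspace :: "'a::metric_space set \<Rightarrow> ('a \<Rightarrow> 'a) metric"
  where "sspace X = submetric (cspace X) {f. f ` X = X}"

lemma mtopology_of_submetric_euclidean: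
  "mtopology_of (submetric euclidean_metric X) = top_of_set X"
  by (simp add: mtopology_of_submetric)

lemma mspace_cspace:
  assumes "compact X"
  shows "mspace (cspace X) = {f \<in> X \<rightarrow>\<^sub>E X. continuous_on X f}"
proof -
  have "compactin (top_of_set X) (topspace (top_of_set X))"
    using assms by (simp add: compactin_subtopology)
  then show ?thesis
    unfolding cspace_def compactin_mspace_cfunspace [OF \<open>compactin _ _\<close>]
    by (auto simp: mtopology_of_submetric_euclidean PiE_def)
qed

lemma mdist_cspace:
  assumes "compact X" "X \<noteq> {}" "f \<in> mspace (cspace X)" "g \<in> mspace (cspace X)"
  shows "mdist (cspace X) f g = (SUP x\<in>X. dist (f x) (g x))"
    and "\<exists>x\<in>X. mdist (cspace X) f g = dist (f x) (g x)"
proof -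
  let ?m = "submetric euclidean_metric X"
  have ff: "f \<in> Metric_space.fspace (mspace ?m) (mdist ?m) X"
       and gg: "g \<in> Metric_space.fspace (mspace ?m) (mdist ?m) X"
    using assms cfunspace_subset_funspace[of "top_of_set X" ?m]
    unfolding cspace_def mspace_funspace by auto
  have "Metric_space (mspace ?m) (mdist ?m)"
    by (rule Metric_space_mspace_mdist)
  then have "Metric_space X dist"
    by simp
  then show eq: "mdist (cspace X) f g = (SUP x\<in>X. dist (f x) (g x))"
    using ff gg assms(2)
    by (simp add: cspace_def mdist_cfunspace_eq_mdist_funspace Metric_space.fdist_def)
  have "continuous_on X (\<lambda>x. dist (f x) (g x))"
    using assms by (auto simp: mspace_cspace intro: continuous_on_dist)
  then obtain x where x: "x \<in> X" "\<forall>y\<in>X. dist (f y) (g y) \<le> dist (f x) (g x)"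
    using continuous_attains_sup assms(1,2) by blast
  then have "(SUP x\<in>X. dist (f x) (g x)) = dist (f x) (g x)"
    by (intro cSup_eq_maximum) auto
  with eq x show "\<exists>x\<in>X. mdist (cspace X) f g = dist (f x) (g x)"
    by auto
qed

section \<open>Shadowing\<close>

definition pseudo_orbit :: "'a::metric_space set \<Rightarrow> ('a \<Rightarrow> 'a) \<Rightarrow> real \<Rightarrow> (nat \<Rightarrow> 'a) \<Rightarrow> bool"
  where "pseudo_orbit X f \<delta> x \<longleftrightarrow> (\<forall>i. x i \<in> X) \<and> (\<forall>i. dist (x (Suc i)) (f (x i)) < \<delta>)"

definition shadowing :: "'a::metric_space set \<Rightarrow> ('a \<Rightarrow> 'a) \<Rightarrow> bool"
  where "shadowing X f \<longleftrightarrow>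
    (\<forall>\<epsilon>>0. \<exists>\<delta>>0. \<forall>x. pseudo_orbit X f \<delta> x \<longrightarrow>
       (\<exists>z\<in>X. \<forall>i. dist (x i) ((f ^^ i) z) < \<epsilon>))"

definition tset :: "'a::metric_space set \<Rightarrow> ('a \<Rightarrow> 'a) set"
  where "tset X = {f \<in> mspace (cspace X). shadowing X f}"

section \<open>Graphs, graphoids and graphites\<close>

text \<open>
  The \<open>n\<close> arcs are given by parametrisations. The intersection condition for the pair \<open>(j, i)\<close>
  says that the intersection also lies in the endpoints of the \<open>j\<close>-th arc. Arcs are
  non-degenerate and \<open>n > 0\<close>, so neither the empty set nor a single point is a graph.
\<close>

definition metric_graph :: "'a::metric_space set \<Rightarrow> bool"
  where "metric_graph G \<longleftrightarrow> compact G \<and> connected G \<and>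
    (\<exists>(n::nat) (\<gamma> :: nat \<Rightarrow> real \<Rightarrow> 'a). n > 0 \<and> (\<forall>i<n. arc (\<gamma> i)) \<and>
       G = (\<Union>i<n. path_image (\<gamma> i)) \<and>
       (\<forall>i<n. \<forall>j<n. i \<noteq> j \<longrightarrow>
          path_image (\<gamma> i) \<inter> path_image (\<gamma> j) \<subseteq> {pathstart (\<gamma> i), pathfinish (\<gamma> i)}))"

definition graphoid :: "'a::metric_space set \<Rightarrow> bool"
  where "graphoid X \<longleftrightarrow> compact X \<and>
    (\<forall>\<epsilon>>0. \<exists>G r. metric_graph G \<and> G \<subseteq> X \<and> retraction X G r \<and>
       (\<forall>x\<in>G. diameter {y \<in> X. r y = x} < \<epsilon>))"

definition graphite :: "'a::metric_space set \<Rightarrow> bool"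
  where "graphite X \<longleftrightarrow> graphoid X \<and> locally connected X"

end

theory Submission
  imports Defs
begin

text \<open>
  For fixed \<open>\<epsilon>\<close>, call a map robust if all its small perturbations have \<open>\<epsilon>\<close>-shadowing. The
  surjections near which \<open>\<epsilon>\<close>-shadowing persists form an open set, and a map lying in these open sets
  for all \<open>\<epsilon> = 1/(n+1)\<close> has shadowing. Since the space of surjections is completely metrizable,
  Baire's theorem reduces the claim to the density of robust surjections
  (\<open>dense_robust_shadowing\<close>).

  Robustness comes from covering relations. Suppose that \<open>r\<close> retracts the space onto a graph \<open>G\<close>
  and moves points very little, and cut \<open>G\<close> into short arcs \<open>E\<^sub>i\<close>. Consider \<open>f = F \<circ> r\<close>, where
  \<open>F\<close> is constant near the vertices of \<open>G\<close> and follows a path \<open>q\<^sub>i\<close> on the middle third of \<open>E\<^sub>i\<close>,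
  such that the image of \<open>r \<circ> q\<^sub>i\<close> is covered by arcs \<open>E\<^sub>l\<close> that \<open>r \<circ> q\<^sub>i\<close> runs through from end to end. A pseudo-orbit of a map \<open>h\<close>
  close to \<open>f\<close> then has an itinerary \<open>E\<^sub>k\<^sub>0, E\<^sub>k\<^sub>1, \<dots>\<close> in which each arc is traversed by
  the path belonging to its predecessor. Traversing an arc forces every nearby path to run, after
  applying \<open>r\<close>, through the middle third of this arc (\<open>robust_crossing\<close>). Hence the initial arc contains a nested
  sequence of parameter intervals whose \<open>n\<close>-th image under \<open>h\<close> stays in the \<open>n\<close>-th tube
  \<open>r\<^sup>-\<^sup>1(E\<^sub>k\<^sub>n)\<close>, and a common parameter gives the shadowing point
  (\<open>robust_shadowing_traversing_map\<close>).
  Coverings are thus required only after projecting by \<open>r\<close>. This matters because the perturbed map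
  may leave the graph and miss most of each arc.

  To put such an \<open>f\<close> near a given surjection \<open>g\<close>, the path \<open>q\<^sub>i\<close> is built near a point \<open>b\<^sub>i\<close> of \<open>G\<close>
  close to \<open>g(E\<^sub>i)\<close>. It makes a small loop at \<open>b\<^sub>i\<close> that fills a ball of the space, and these balls together make \<open>f\<close>
  surjective; then it traverses all arcs meeting \<open>r(V)\<close> for a small connected set \<open>V\<close> that contains the
  loop. These arcs form a connected, hence path connected, subgraph, so the traversal
  can be arranged inside it. Both the sets \<open>V\<close> and the loops come from local connectedness, the loops by a
  local form of the Hahn--Mazurkiewicz theorem (\<open>local_Hahn_Mazurkiewicz\<close>).
\<close>

section \<open>Small loops that fill small balls\<close>

text \<open>
  The radius is a Lebesgue number of the cover of \<open>X\<close> by open sets that lie in small connected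
  sets.
\<close>

lemma uniformly_locally_connected:
  fixes X :: "'a::metric_space set"
  assumes "compact X" "locally connected X" "\<eta> > 0"
  obtains \<delta> where "\<delta> > 0"
    "\<And>b. b \<in> X \<Longrightarrow> \<exists>V. connected V \<and> V \<subseteq> X \<inter> ball b \<eta> \<and> X \<inter> ball b \<delta> \<subseteq> V"
proof -
  have "\<exists>T V. open T \<and> connected V \<and> x \<in> T \<and> X \<inter> T \<subseteq> V \<and> V \<subseteq> X \<inter> ball x (\<eta>/2)"
    if "x \<in> X" for x
  proof -
    let ?W = "X \<inter> ball x (\<eta>/2)"
    have "openin (top_of_set X) ?W \<and> x \<in> ?W" using assms(3) that by (auto simp: openin_open_Int)
    then have "\<exists>u v. openin (top_of_set X) u \<and> connected v \<and> x \<in> u \<and> u \<subseteq> v \<and> v \<subseteq> ?W"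
      using assms(2) unfolding locally_def by (elim allE[of _ ?W]) blast
    then obtain u v where uv: "openin (top_of_set X) u" "connected v" "x \<in> u" "u \<subseteq> v" "v \<subseteq> ?W"
      by blast
    then obtain T where "open T" "u = X \<inter> T" by (auto simp: openin_open)
    then show ?thesis using uv by blast
  qed
  then obtain T V where TV: "\<And>x. x \<in> X \<Longrightarrow> open (T x) \<and> connected (V x) \<and> x \<in> T x
      \<and> X \<inter> T x \<subseteq> V x \<and> V x \<subseteq> X \<inter> ball x (\<eta>/2)"
    by metis
  have "X \<subseteq> \<Union>(T ` X)" using TV by blast
  then obtain \<delta> where \<delta>: "\<delta> > 0" "\<And>x. x \<in> X \<Longrightarrow> \<exists>G \<in> T ` X. ball x \<delta> \<subseteq> G"
    using Heine_Borel_lemma[OF assms(1), of "T ` X"] TV by (metis imageE)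
  have "\<exists>V. connected V \<and> V \<subseteq> X \<inter> ball b \<eta> \<and> X \<inter> ball b \<delta> \<subseteq> V" if "b \<in> X" for b
  proof -
    obtain x where x: "x \<in> X" "ball b \<delta> \<subseteq> T x" using \<delta>(2)[OF \<open>b \<in> X\<close>] by blast
    have sub: "X \<inter> ball b \<delta> \<subseteq> V x" using x TV[OF x(1)] by blast
    then have "b \<in> V x" using that \<delta>(1) by auto
    then have "dist x b < \<eta>/2" using TV[OF x(1)] by auto
    moreover have "dist x y < \<eta>/2" "y \<in> X" if "y \<in> V x" for y using TV[OF x(1)] that by auto
    ultimately have "V x \<subseteq> X \<inter> ball b \<eta>"
      by (smt (verit, best) IntI dist_commute dist_triangle mem_ball subsetI field_sum_of_halves)
    then show ?thesis using sub TV[OF x(1)] by blast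
  qed
  with \<delta>(1) show ?thesis using that by blast
qed

text \<open>
  Being joined by a chain is an equivalence relation on \<open>V\<close> whose classes are relatively open, so
  there is only one class.
\<close>

lemma connected_imp_fine_chain:
  fixes V :: "'a::metric_space set"
  assumes "connected V" "a \<in> V" "b \<in> V" "\<delta> > 0"
  shows "\<exists>xs. xs \<noteq> [] \<and> hd xs = a \<and> last xs = b \<and>
           successively (\<lambda>x y. dist x y < \<delta>) xs \<and> set xs \<subseteq> V"
proof -
  define R where "R x y \<longleftrightarrow> (\<exists>xs. xs \<noteq> [] \<and> hd xs = x \<and> last xs = y \<and>
           successively (\<lambda>x y. dist x y < \<delta>) xs \<and> set xs \<subseteq> V)" for x y
  have "R a b"
    using assms(1-3)
  proof (rule connected_equivalence_relation)
    show "R y x" if "R x y" for x y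
    proof -
      from that obtain xs where "xs \<noteq> []" "hd xs = x" "last xs = y"
        "successively (\<lambda>x y. dist x y < \<delta>) xs" "set xs \<subseteq> V" unfolding R_def by blast
      then show ?thesis unfolding R_def
        by (intro exI[of _ "rev xs"]) (auto simp: hd_rev last_rev dist_commute)
    qed
    show "R x z" if "R x y" "R y z" for x y z
    proof -
      obtain xs where xs: "xs \<noteq> []" "hd xs = x" "last xs = y"
        "successively (\<lambda>x y. dist x y < \<delta>) xs" "set xs \<subseteq> V" using \<open>R x y\<close> unfolding R_def by blast
      obtain ys where "ys \<noteq> []" "hd ys = y" "last ys = z"
        "successively (\<lambda>x y. dist x y < \<delta>) ys" "set ys \<subseteq> V" using \<open>R y z\<close> unfolding R_def by blast
      with xs show ?thesis unfolding R_def using assms(4)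
        by (intro exI[of _ "xs @ ys"]) (auto simp: successively_append_iff)
    qed
    show "\<exists>T. openin (top_of_set V) T \<and> x \<in> T \<and> (\<forall>y\<in>T. R x y)" if "x \<in> V" for x
    proof (intro exI[of _ "V \<inter> ball x \<delta>"] conjI ballI)
      show "R x y" if "y \<in> V \<inter> ball x \<delta>" for y
        unfolding R_def using that \<open>x \<in> V\<close> by (intro exI[of _ "[x,y]"]) auto
    qed (use that assms(4) in auto)
  qed
  then show ?thesis unfolding R_def .
qed

lemma connected_imp_fine_chain_through:
  fixes V :: "'a::metric_space set"
  assumes "connected V" "a \<in> V" "b \<in> V" "\<delta> > 0" "finite N" "N \<subseteq> V"
  shows "\<exists>xs. xs \<noteq> [] \<and> hd xs = a \<and> last xs = b \<and>
           successively (\<lambda>x y. dist x y < \<delta>) xs \<and> set xs \<subseteq> V \<and> N \<subseteq> set xs"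
  using assms(5,6)
proof (induction N rule: finite_induct)
  case empty
  then show ?case using connected_imp_fine_chain[OF assms(1-4)] by auto
next
  case (insert x N)
  then obtain xs where xs: "xs \<noteq> []" "hd xs = a" "last xs = b"
      "successively (\<lambda>x y. dist x y < \<delta>) xs" "set xs \<subseteq> V" "N \<subseteq> set xs" by auto
  obtain ys where ys: "ys \<noteq> []" "hd ys = b" "last ys = x"
      "successively (\<lambda>x y. dist x y < \<delta>) ys" "set ys \<subseteq> V"
    using connected_imp_fine_chain[OF assms(1,3) _ assms(4), of x] insert.prems by auto
  obtain zs where zs: "zs \<noteq> []" "hd zs = x" "last zs = b"
      "successively (\<lambda>x y. dist x y < \<delta>) zs" "set zs \<subseteq> V"
    using connected_imp_fine_chain[OF assms(1) _ assms(3,4), of x] insert.prems by auto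
  have "x \<in> set ys" using ys by (metis last_in_set)
  then show ?case using xs ys zs assms(4)
    by (intro exI[of _ "xs @ ys @ zs"]) (auto simp: successively_append_iff)
qed

text \<open>
  The set \<open>V\<close> may fail to be compact, so the net comes from one of \<open>X\<close>, each of whose points is
  replaced by a nearby point of \<open>V\<close> if there is one.
\<close>

lemma finite_net_inside:
  fixes X :: "'a::metric_space set"
  assumes "compact X" "V \<subseteq> X" "\<delta> > 0"
  obtains N where "finite N" "N \<subseteq> V" "\<And>x. x \<in> V \<Longrightarrow> \<exists>y\<in>N. dist y x < \<delta>"
proof -
  obtain K where K: "finite K" "X \<subseteq> (\<Union>x\<in>K. ball x (\<delta>/2))"
    using assms(1,3) unfolding compact_eq_totally_bounded by (meson half_gt_zero)
  define s where "s k = (SOME v. v \<in> V \<and> dist k v < \<delta>/2)" for k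
  have s: "s k \<in> V \<and> dist k (s k) < \<delta>/2" if "v \<in> V" "dist k v < \<delta>/2" for k v
    unfolding s_def by (rule someI[of _ v]) (use that in auto)
  show ?thesis
  proof (rule that[of "s ` K \<inter> V"])
    fix x assume "x \<in> V"
    then obtain k where k: "k \<in> K" "dist k x < \<delta>/2" using K assms(2) by auto
    then have "dist (s k) x < \<delta>" using s[OF \<open>x \<in> V\<close> k(2)]
      by (smt (verit) dist_commute dist_triangle field_sum_of_halves)
    then show "\<exists>y\<in>s ` K \<inter> V. dist y x < \<delta>" using k(1) s[OF \<open>x \<in> V\<close> k(2)] by blast
  qed (use K(1) in auto)
qed

text \<open>
  The refinement step for the next lemma: one step from \<open>a\<close> to \<open>a'\<close> is replaced by a walk with finer
  steps that passes near every point of a ball around \<open>a\<close>. The length \<open>m\<close> can be any large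
  number, since the walk may rest at its end; so all steps of a longer walk can be refined by walks of
  one common length.
\<close>

lemma fine_walk_covering_ball:
  fixes X :: "'a::metric_space set"
  assumes "compact X" "\<delta>' > 0" "\<delta> > 0"
    and V: "connected V" "V \<subseteq> X \<inter> ball a \<epsilon>" "X \<inter> ball a \<delta> \<subseteq> V"
    and a: "a \<in> X" "a' \<in> X" "dist a a' < \<delta>"
  shows "\<exists>M>0. \<forall>m\<ge>M. \<exists>c. c 0 = a \<and> c m = a' \<and> (\<forall>j. dist (c j) (c (Suc j)) < \<delta>') \<and>
     (\<forall>j. c j \<in> X \<inter> ball a \<epsilon>) \<and> (\<forall>x\<in>X \<inter> ball a \<delta>. \<exists>j<m. dist (c j) x < (\<delta>'::real))"
proof -
  have aV: "a \<in> V" "a' \<in> V" using V a assms by auto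
  have "V \<subseteq> X" using V by auto
  obtain N where N: "finite N" "N \<subseteq> V" "\<And>x. x \<in> V \<Longrightarrow> \<exists>y\<in>N. dist y x < \<delta>'"
    using finite_net_inside[OF assms(1) \<open>V \<subseteq> X\<close> assms(2)] by blast
  obtain xs where xs: "xs \<noteq> []" "hd xs = a" "last xs = a'"
    "successively (\<lambda>x y. dist x y < \<delta>') xs" "set xs \<subseteq> V" "N \<subseteq> set xs"
    using connected_imp_fine_chain_through[OF V(1) aV assms(2) N(1,2)] by blast
  define c where "c j = (if j < length xs then xs ! j else a')" for j
  have "dist (c j) (c (Suc j)) < \<delta>'" for j
  proof -
    consider "Suc j < length xs" | "Suc j = length xs" | "length xs \<le> j" by linarith
    then show ?thesis
    proof cases
      case 1 then show ?thesis using xs(4) by (simp add: c_def successively_conv_nth)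
    next
      case 2
      then have "xs ! j = a'" using xs(1,3) by (metis diff_Suc_1 last_conv_nth)
      then show ?thesis using 2 assms(2) by (simp add: c_def)
    next
      case 3 then show ?thesis using assms(2) by (simp add: c_def)
    qed
  qed
  moreover have "c j \<in> X \<inter> ball a \<epsilon>" for j
    using subsetD[OF V(2)] aV subsetD[OF xs(5) nth_mem] by (auto simp: c_def)
  moreover have "\<exists>j<m. dist (c j) x < \<delta>'" if x: "x \<in> X \<inter> ball a \<delta>" and m: "m \<ge> length xs" for x m
  proof -
    obtain y where "y \<in> N" "dist y x < \<delta>'" using N(3) x V(3) by blast
    then obtain j where "j < length xs" "xs ! j = y" using xs(6) by (metis in_set_conv_nth subsetD)
    then show ?thesis using m \<open>dist y x < \<delta>'\<close> by (intro exI[of _ j]) (auto simp: c_def)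
  qed
  moreover have "c 0 = a" using xs(1,2) by (simp add: c_def hd_conv_nth)
  moreover have "c m = a'" if "m \<ge> length xs" for m using that by (simp add: c_def)
  ultimately show ?thesis using xs(1)
    by (intro exI[of _ "length xs"]) (metis length_greater_0_conv)
qed

text \<open>
  Refine the walk that rests at \<open>b\<close> again and again. At stage \<open>n\<close> a step shorter than \<open>\<delta> n\<close> is
  replaced by a walk inside a connected set of radius \<open>\<epsilon> n\<close> around its starting point, with
  steps shorter than \<open>\<delta> (n + 1)\<close>. Read as step functions on the unit interval, the walks converge
  uniformly because the \<open>\<epsilon> n\<close> are summable, and the limit is continuous because the jumps tend to 0. A
  point \<open>\<delta> n\<close>-close to the \<open>n\<close>-th walk is \<open>\<delta> (n + 1)\<close>-close to the next one, so
  every point of the ball of radius \<open>\<delta> 0\<close> is a limit of points on the loop.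
\<close>

lemma local_Hahn_Mazurkiewicz:
  fixes X :: "'a::metric_space set"
  assumes "compact X" "locally connected X" "\<eta> > 0"
  obtains \<delta> where "\<delta> > 0"
    "\<And>b. b \<in> X \<Longrightarrow> \<exists>e. path e \<and> pathstart e = b \<and> pathfinish e = b \<and>
        path_image e \<subseteq> X \<inter> ball b \<eta> \<and> X \<inter> ball b \<delta> \<subseteq> path_image e"
proof -
  define \<epsilon> where "\<epsilon> n = \<eta> / 2 ^ (n + 2)" for n
  have \<epsilon>: "\<epsilon> n > 0" "\<epsilon> (Suc n) = \<epsilon> n / 2" for n using assms(3) by (auto simp: \<epsilon>_def)
  define C where "C n d \<longleftrightarrow> d > 0 \<and> d \<le> \<epsilon> n \<and> (\<forall>b\<in>X. \<exists>V. connected V \<and> V \<subseteq> X \<inter> ball b (\<epsilon> n) \<and> X \<inter> ball b d \<subseteq> V)"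
    for n d
  have "\<exists>d. C n d" for n
  proof -
    obtain d where d: "d > 0" "\<And>b. b \<in> X \<Longrightarrow> \<exists>V. connected V \<and> V \<subseteq> X \<inter> ball b (\<epsilon> n) \<and> X \<inter> ball b d \<subseteq> V"
      using uniformly_locally_connected[OF assms(1,2) \<epsilon>(1)[of n]] by metis
    have "X \<inter> ball b (min d (\<epsilon> n)) \<subseteq> X \<inter> ball b d" for b by auto
    then have "C n (min d (\<epsilon> n))" unfolding C_def using d \<epsilon>(1)[of n]
      by (auto simp: subset_iff) metis
    then show ?thesis by blast
  qed
  then obtain \<delta> where \<delta>C: "\<And>n. C n (\<delta> n)" by metis
  have \<delta>: "\<delta> n > 0" "\<delta> n \<le> \<epsilon> n" for n using \<delta>C C_def by auto
  have ulc: "\<exists>V. connected V \<and> V \<subseteq> X \<inter> ball b (\<epsilon> n) \<and> X \<inter> ball b (\<delta> n) \<subseteq> V" if "b \<in> X" for b n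
    using \<delta>C C_def that by auto
  have \<epsilon>lim: "\<epsilon> \<longlonglongrightarrow> 0"
  proof -
    have "(\<lambda>n. \<eta>/4 * (1/2)^n) \<longlonglongrightarrow> \<eta>/4 * 0"
      by (intro tendsto_mult tendsto_const LIMSEQ_realpow_zero) auto
    then show ?thesis by (simp add: \<epsilon>_def[abs_def] power_add power_divide mult.commute)
  qed
  have "\<exists>e. path e \<and> pathstart e = b \<and> pathfinish e = b \<and>
        path_image e \<subseteq> X \<inter> ball b \<eta> \<and> X \<inter> ball b (\<delta> 0) \<subseteq> path_image e" if b: "b \<in> X" for b
  proof -
    \<comment> \<open>a walk is a pair of its length and its vertices; stage 0 is the single step from \<open>b\<close> to \<open>b\<close>\<close>
    define P where "P n s \<longleftrightarrow> (case s of (N::nat, p) \<Rightarrow> N > 0 \<and> (n = 0 \<longrightarrow> N = 1) \<and> (\<forall>i. p i \<in> X) \<and> p 0 = b \<and> p N = b \<and>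
        (\<forall>i<N. dist (p i) (p (Suc i)) < \<delta> n))" for n s
    define Q where "Q n s s' \<longleftrightarrow> (case s of (N::nat, p) \<Rightarrow> case s' of (N'::nat, p') \<Rightarrow>
        \<exists>m>0. N' = N * m \<and> (\<forall>k\<le>N'. dist (p' k) (p (k div m)) < \<epsilon> n) \<and>
         (\<forall>x\<in>X. \<forall>i<N. dist (p i) x < \<delta> n \<longrightarrow> (\<exists>k<N'. dist (p' k) x < \<delta> (Suc n))))" for n s s'
    have "\<exists>s. \<forall>n. P n (s n) \<and> Q n (s n) (s (Suc n))"
    proof (rule dependent_nat_choice)
      show "\<exists>x. P 0 x" using b \<delta>(1) by (intro exI[of _ "(1, \<lambda>_. b)"]) (auto simp: P_def)
      fix s n assume "P n s"
      obtain N p where s: "s = (N, p)" by fastforce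
      have p: "N > 0" "\<And>i. p i \<in> X" "p 0 = b" "p N = b" "\<And>i. i < N \<Longrightarrow> dist (p i) (p (Suc i)) < \<delta> n"
        using \<open>P n s\<close> by (auto simp: s P_def)
      define W where "W i m c \<longleftrightarrow> c 0 = p i \<and> c m = p (Suc i) \<and>
          (\<forall>j. dist (c j) (c (Suc j)) < \<delta> (Suc n)) \<and> (\<forall>j. c j \<in> X \<inter> ball (p i) (\<epsilon> n)) \<and>
          (\<forall>x\<in>X \<inter> ball (p i) (\<delta> n). \<exists>j<m. dist (c j) x < \<delta> (Suc n))" for i m c
      have "\<exists>M>0. \<forall>m\<ge>M. \<exists>c. W i m c" if "i < N" for i
      proof -
        obtain V where "connected V" "V \<subseteq> X \<inter> ball (p i) (\<epsilon> n)" "X \<inter> ball (p i) (\<delta> n) \<subseteq> V"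
          using ulc p(2) by meson
        from fine_walk_covering_ball[OF assms(1) \<delta>(1) \<delta>(1) this p(2) p(2) p(5)[OF that]]
        show ?thesis unfolding W_def .
      qed
      then have "\<forall>i. \<exists>M. i < N \<longrightarrow> M > 0 \<and> (\<forall>m\<ge>M. \<exists>c. W i m c)" by blast
      from choice[OF this] obtain M where M: "\<And>i. i < N \<Longrightarrow> M i > 0"
        "\<And>i m. i < N \<Longrightarrow> m \<ge> M i \<Longrightarrow> \<exists>c. W i m c" by blast
      define m where "m = (\<Sum>i<N. M i)"
      have mM: "m \<ge> M i" if "i < N" for i unfolding m_def using that by (intro member_le_sum) auto
      have m0: "m > 0" using mM[OF p(1)] M(1)[OF p(1)] by linarith
      have "\<forall>i. \<exists>c. i < N \<longrightarrow> W i m c" using M(2) mM by blast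
      from choice[OF this] obtain c where "\<And>i. i < N \<Longrightarrow> W i m (c i)" by blast
      then have c: "c i 0 = p i" "c i m = p (Suc i)" "dist (c i j) (c i (Suc j)) < \<delta> (Suc n)"
          "c i j \<in> X \<inter> ball (p i) (\<epsilon> n)"
          "x \<in> X \<inter> ball (p i) (\<delta> n) \<Longrightarrow> \<exists>j<m. dist (c i j) x < \<delta> (Suc n)" if "i < N" for i j x
        using that unfolding W_def by blast+
      define p' where "p' k = (if k < N * m then c (k div m) (k mod m) else b)" for k
      have divN: "k div m < N" if "k < N * m" for k using that m0
        by (simp add: less_mult_imp_div_less)
      \<comment> \<open>at the seam between two refined steps the end of one walk is the start of the next\<close>
      have suc: "p' (Suc k) = c (k div m) (Suc (k mod m))" if k: "k < N * m" for k
      proof (cases "Suc (k mod m) = m")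
        case True
        have "Suc k = k div m * m + Suc (k mod m)" by simp
        then have e: "Suc k = Suc (k div m) * m" using True by simp
        have "c (k div m) m = p (Suc (k div m))" using c(2) divN[OF k] by blast
        moreover have "p' (Suc k) = p (Suc (k div m))"
        proof (cases "Suc (k div m) < N")
          case True
          then have "Suc k < N * m" unfolding e using m0 by (metis mult_less_mono1)
          then show ?thesis using c(1)[OF True] m0 by (simp add: p'_def e del: mult_Suc)
        next
          case False
          then have "Suc (k div m) = N" using divN[OF k] by linarith
          then show ?thesis using e p(4) by (simp add: p'_def)
        qed
        ultimately show ?thesis using True by simp
      next
        case False
        then have l: "Suc (k mod m) < m" using m0 by (meson Suc_lessI mod_less_divisor)
        have e: "Suc k = k div m * m + Suc (k mod m)" by simp
        have "Suc k div m = k div m" "Suc k mod m = Suc (k mod m)"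
          using l by (simp_all add: div_Suc mod_Suc)
        moreover have "Suc k < N * m"
        proof -
          have "Suc k < Suc (k div m) * m" using e l by (metis add.commute add_less_mono1 mult_Suc)
          also have "\<dots> \<le> N * m" using divN[OF k] by (intro mult_le_mono1) simp
          finally show ?thesis .
        qed
        ultimately show ?thesis by (simp add: p'_def)
      qed
      have "P (Suc n) (N * m, p')"
        unfolding P_def prod.case
      proof (intro conjI allI impI)
        show "0 < N * m" using p(1) m0 by simp
        show "N * m = 1" if "Suc n = 0" using that by simp
        show "p' i \<in> X" for i using c(4) divN b by (auto simp: p'_def)
        show "p' 0 = b" using c(1)[OF p(1)] p(3) p(1) m0 by (simp add: p'_def)
        show "p' (N * m) = b" by (simp add: p'_def)
        show "dist (p' i) (p' (Suc i)) < \<delta> (Suc n)" if "i < N * m" for i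
          unfolding suc[OF that] using that c(3) divN[OF that] by (simp add: p'_def)
      qed
      moreover have "Q n s (N * m, p')"
        unfolding Q_def s prod.case
      proof (rule exI[of _ m], intro conjI allI impI ballI)
        show "dist (p' k) (p (k div m)) < \<epsilon> n" if "k \<le> N * m" for k
        proof (cases "k = N * m")
          case True then show ?thesis using p(4) m0 \<epsilon>(1) by (simp add: p'_def)
        next
          case False
          then have k: "k < N * m" using that by simp
          then show ?thesis using c(4)[OF divN[OF k]] k by (simp add: p'_def dist_commute)
        qed
        fix x i assume x: "x \<in> X" "i < N" "dist (p i) x < \<delta> n"
        then obtain j where j: "j < m" "dist (c i j) x < \<delta> (Suc n)" using c(5)[OF x(2)] x by auto
        have "i * m + j < N * m"
        proof -
          have "i * m + j < Suc i * m" using j by simp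
          also have "\<dots> \<le> N * m" using x by (intro mult_le_mono1) simp
          finally show ?thesis .
        qed
        moreover have "p' (i * m + j) = c i j" using calculation j by (simp add: p'_def)
        ultimately show "\<exists>k<N * m. dist (p' k) x < \<delta> (Suc n)" using j by auto
      qed (use m0 in auto)
      ultimately show "\<exists>y. P (Suc n) y \<and> Q n s y" by blast
    qed
    then obtain s where s: "\<And>n. P n (s n)" "\<And>n. Q n (s n) (s (Suc n))" by blast
    define N where "N n = fst (s n)" for n
    define p where "p n = snd (s n)" for n
    have sNp: "s n = (N n, p n)" for n by (simp add: N_def p_def)
    have p: "N n > 0" "p n i \<in> X" "p n 0 = b" "p n (N n) = b"
      "\<And>i. i < N n \<Longrightarrow> dist (p n i) (p n (Suc i)) < \<delta> n" for n i
      using s(1)[of n] by (auto simp: P_def sNp)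
    have "\<forall>n. \<exists>m>0. N (Suc n) = N n * m \<and> (\<forall>k\<le>N (Suc n). dist (p (Suc n) k) (p n (k div m)) < \<epsilon> n) \<and>
         (\<forall>x\<in>X. \<forall>i<N n. dist (p n i) x < \<delta> n \<longrightarrow> (\<exists>k<N (Suc n). dist (p (Suc n) k) x < \<delta> (Suc n)))"
      using s(2) unfolding Q_def sNp prod.case by blast
    then obtain m where m: "\<And>n. m n > 0" "\<And>n. N (Suc n) = N n * m n"
      "\<And>n k. k \<le> N (Suc n) \<Longrightarrow> dist (p (Suc n) k) (p n (k div m n)) < \<epsilon> n"
      "\<And>n x i. \<lbrakk>x \<in> X; i < N n; dist (p n i) x < \<delta> n\<rbrakk> \<Longrightarrow> \<exists>k<N (Suc n). dist (p (Suc n) k) x < \<delta> (Suc n)"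
      by metis
    \<comment> \<open>the step function of the \<open>n\<close>-th walk, which takes the value \<open>b\<close> at 1\<close>
    define q where "q n t = p n (nat \<lfloor>t * N n\<rfloor>)" for n and t :: real
    have qX: "q n t \<in> X" for n t by (simp add: q_def p)
    have q1: "dist (q (Suc n) t) (q n t) < \<epsilon> n" if t: "0 \<le> t" "t \<le> 1" for n t
    proof -
      have "t * N (Suc n) \<le> N (Suc n)" using t by (simp add: mult_left_le_one_le)
      then have "nat \<lfloor>t * N (Suc n)\<rfloor> \<le> N (Suc n)" by linarith
      moreover have "\<lfloor>t * N n\<rfloor> = \<lfloor>t * N (Suc n)\<rfloor> div int (m n)"
        using floor_divide_real_eq_div[of "int (m n)" "t * N (Suc n)"] m(1)[of n] by (simp add: m(2))
      then have "nat \<lfloor>t * N n\<rfloor> = nat \<lfloor>t * N (Suc n)\<rfloor> div m n"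
        using t by (simp add: nat_div_distrib)
      ultimately show ?thesis unfolding q_def using m(3) by metis
    qed
    \<comment> \<open>telescoping, as \<open>\<epsilon> n = 2 * (\<epsilon> n - \<epsilon> (n + 1))\<close>\<close>
    have q2: "dist (q (n + k) t) (q n t) \<le> 2 * \<epsilon> n - 2 * \<epsilon> (n + k)" if t: "0 \<le> t" "t \<le> 1" for n k t
    proof (induction k)
      case 0 then show ?case by simp
    next
      case (Suc k)
      then show ?case using q1[OF t, of "n + k"] \<epsilon>(2)[of "n + k"]
          dist_triangle[of "q (n + Suc k) t" "q n t" "q (n + k) t"] by simp
    qed
    have "\<exists>l\<in>X. (\<lambda>n. q n t) \<longlonglongrightarrow> l" if t: "0 \<le> t" "t \<le> 1" for t
    proof -
      have "Cauchy (\<lambda>n. q n t)"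
        unfolding metric_Cauchy_iff2
      proof
        fix j
        obtain n where n: "\<epsilon> n < inverse (real (Suc j)) / 4"
          using order_tendstoD(2)[OF \<epsilon>lim, of "inverse (real (Suc j)) / 4"]
          by (meson divide_pos_pos eventually_sequentially inverse_positive_iff_positive of_nat_0_less_iff order_refl zero_less_Suc zero_less_numeral)
        have *: "dist (q k t) (q n t) \<le> 2 * \<epsilon> n" if "k \<ge> n" for k
          using q2[OF t, of n "k - n"] \<epsilon>(1)[of k] that by simp
        then have "\<forall>ma\<ge>n. \<forall>k\<ge>n. dist (q ma t) (q k t) < inverse (real (Suc j))"
        proof (intro allI impI)
          fix i k assume "i \<ge> n" "k \<ge> n"
          then have "dist (q i t) (q k t) \<le> 2 * \<epsilon> n + 2 * \<epsilon> n"
            using * dist_triangle2[of "q i t" "q k t" "q n t"] by (meson add_mono order_trans)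
          then show "dist (q i t) (q k t) < inverse (real (Suc j))" using n by simp
        qed
        then show "\<exists>M. \<forall>m\<ge>M. \<forall>n\<ge>M. dist (q m t) (q n t) < inverse (real (Suc j))" by blast
      qed
      then show ?thesis using completeE[OF compact_imp_complete[OF assms(1)], of "\<lambda>n. q n t"] qX by blast
    qed
    then obtain e where e: "\<And>t. \<lbrakk>0 \<le> t; t \<le> 1\<rbrakk> \<Longrightarrow> e t \<in> X \<and> (\<lambda>n. q n t) \<longlonglongrightarrow> e t" by metis
    have eq: "dist (e t) (q n t) \<le> 2 * \<epsilon> n" if t: "0 \<le> t" "t \<le> 1" for n t
    proof (rule LIMSEQ_le_const2)
      show "(\<lambda>k. dist (q k t) (q n t)) \<longlonglongrightarrow> dist (e t) (q n t)"
        using e[OF t] by (intro tendsto_dist tendsto_const) auto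
      show "\<exists>M. \<forall>k\<ge>M. dist (q k t) (q n t) \<le> 2 * \<epsilon> n"
      proof (intro exI[of _ n] allI impI)
        fix k assume "k \<ge> n"
        then show "dist (q k t) (q n t) \<le> 2 * \<epsilon> n"
          using q2[OF t, of n "k - n"] \<epsilon>(1)[of k] by simp
      qed
    qed
    have q3: "dist (q n t) (q n u) < \<delta> n" if t: "0 \<le> t" "t \<le> u" "u \<le> 1" "u - t < 1 / N n" for n t u
    proof -
      have N: "real (N n) > 0" using p(1) by simp
      have "u * N n - t * N n < 1" using t(4) N by (simp add: field_simps)
      moreover have "t * N n \<le> u * N n" using t N by (intro mult_right_mono) auto
      moreover have "u * N n \<le> N n" "0 \<le> t * N n" using t N by (auto simp: mult_left_le_one_le)
      ultimately have "nat \<lfloor>u * N n\<rfloor> = nat \<lfloor>t * N n\<rfloor> \<or>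
           (nat \<lfloor>u * N n\<rfloor> = Suc (nat \<lfloor>t * N n\<rfloor>) \<and> nat \<lfloor>t * N n\<rfloor> < N n)"
        by linarith
      then show ?thesis unfolding q_def using \<delta>(1)[of n] p(5)[of "nat \<lfloor>t * N n\<rfloor>" n] by auto
    qed
    have cont: "continuous_on {0..1} e"
      unfolding continuous_on_iff
    proof (intro ballI allI impI)
      fix t d :: real assume t: "t \<in> {0..1}" and d: "d > 0"
      obtain n where n: "\<epsilon> n < d/6"
        using order_tendstoD(2)[OF \<epsilon>lim, of "d/6"] d by (auto simp: eventually_sequentially)
      have *: "dist (e u) (e v) < d" if "0 \<le> u" "u \<le> v" "v \<le> 1" "v - u < 1 / N n" for u v
      proof -
        have "dist (e u) (e v) \<le> dist (e u) (q n u) + (dist (q n u) (q n v) + dist (q n v) (e v))"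
          by (meson add_left_mono dist_triangle order_trans)
        moreover have "dist (e u) (q n u) \<le> 2 * \<epsilon> n" "dist (q n v) (e v) \<le> 2 * \<epsilon> n"
          using eq[of u n] eq[of v n] that by (simp_all add: dist_commute)
        moreover have "dist (q n u) (q n v) < \<epsilon> n" using q3[OF that] \<delta>(2)[of n] by simp
        ultimately show ?thesis using n \<epsilon>(1)[of n] by simp
      qed
      show "\<exists>d'>0. \<forall>x'\<in>{0..1}. dist x' t < d' \<longrightarrow> dist (e x') (e t) < d"
      proof (intro exI[of _ "1 / N n"] conjI ballI impI)
        fix u assume "u \<in> {0..1}" "dist u t < 1 / N n"
        then show "dist (e u) (e t) < d" using *[of u t] *[of t u] t
          by (cases "u \<le> t") (auto simp: dist_real_def dist_commute)
      qed (use p(1) in simp)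
    qed
    have "path e" using cont by (simp add: path_def)
    moreover have "pathstart e = b"
    proof -
      have "(\<lambda>n. q n 0) \<longlonglongrightarrow> b" by (simp add: q_def p)
      then show ?thesis using e[of 0] LIMSEQ_unique by (auto simp: pathstart_def)
    qed
    moreover have "pathfinish e = b"
    proof -
      have "(\<lambda>n. q n 1) \<longlonglongrightarrow> b" by (simp add: q_def p)
      then show ?thesis using e[of 1] LIMSEQ_unique by (auto simp: pathfinish_def)
    qed
    moreover have "path_image e \<subseteq> X \<inter> ball b \<eta>"
    proof -
      have "e t \<in> X \<inter> ball b \<eta>" if t: "0 \<le> t" "t \<le> 1" for t
      proof -
        have "dist (e t) b < \<eta>"
        proof -
          have "N 0 = 1" using s(1)[of 0] by (simp add: P_def sNp)
          moreover have "nat \<lfloor>t\<rfloor> = 0 \<or> nat \<lfloor>t\<rfloor> = 1" using t by linarith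
          ultimately have "q 0 t = b" using p(3,4)[of 0] by (auto simp: q_def)
          then show ?thesis using eq[OF t, of 0] assms(3) by (simp add: \<epsilon>_def)
        qed
        then show ?thesis using e[OF t] by (simp add: dist_commute)
      qed
      then show ?thesis by (auto simp: path_image_def)
    qed
    moreover have "X \<inter> ball b (\<delta> 0) \<subseteq> path_image e"
    proof
      fix x assume x: "x \<in> X \<inter> ball b (\<delta> 0)"
      have ind: "\<exists>i<N n. dist (p n i) x < \<delta> n" for n
      proof (induction n)
        case 0 then show ?case using p(1,3)[of 0] x by auto
      next
        case (Suc n) then show ?case using m(4) x by blast
      qed
      have "x \<in> closure (path_image e)"
        unfolding closure_approachable
      proof (intro allI impI)
        fix d :: real assume d: "d > 0"
        obtain n where n: "\<epsilon> n < d/6"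
          using order_tendstoD(2)[OF \<epsilon>lim, of "d/6"] d by (auto simp: eventually_sequentially)
        obtain i where i: "i < N n" "dist (p n i) x < \<delta> n" using ind by blast
        define t where "t = real i / N n"
        have t: "0 \<le> t" "t \<le> 1" using i by (auto simp: t_def)
        have "q n t = p n i" using p(1)[of n] by (simp add: q_def t_def)
        then have "dist (e t) x < d" using eq[OF t, of n] i(2) n \<delta>(2)[of n] dist_triangle[of "e t" x "p n i"]
            d by simp
        then show "\<exists>y\<in>path_image e. dist y x < d" using t by (auto simp: path_image_def)
      qed
      moreover have "closed (path_image e)" using \<open>path e\<close> by (rule closed_path_image)
      ultimately show "x \<in> path_image e" by simp
    qed
    ultimately show ?thesis by blast
  qed
  with \<delta>(1) show ?thesis using that by blast
qed

section \<open>Paths that run through arcs\<close>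

text \<open>
  The passage need not be injective: it has to run from the start to the end of \<open>g\<close> without
  leaving the image of \<open>g\<close>, and it may go back and forth in between. A path whose image merely contains
  that of \<open>g\<close> need not do this, since it may enter the two halves of \<open>g\<close> from different ends.
\<close>

definition traverses :: "(real \<Rightarrow> 'a) \<Rightarrow> (real \<Rightarrow> 'a::topological_space) \<Rightarrow> bool"
  where "traverses p g \<longleftrightarrow> (\<exists>a b. 0 \<le> a \<and> a < b \<and> b \<le> 1 \<and> p a = pathstart g \<and> p b = pathfinish g \<and>
           p ` {a..b} \<subseteq> path_image g)"

lemma traverses_self: "traverses g g"
  unfolding traverses_def by (intro exI[of _ 0] exI[of _ 1]) (auto simp: pathstart_def pathfinish_def path_image_def)

lemma traverses_joinI1:
  assumes "traverses p g"
  shows "traverses (p +++ q) g"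
proof -
  obtain a b where ab: "0 \<le> a" "a < b" "b \<le> 1" "p a = pathstart g" "p b = pathfinish g"
    "p ` {a..b} \<subseteq> path_image g" using assms unfolding traverses_def by blast
  have "(+++) p q x \<in> path_image g" if "x \<in> {a/2..b/2}" for x
    using that ab subsetD[OF ab(6), of "p (2*x)"] by (auto simp: joinpaths_def)
  then show ?thesis
    unfolding traverses_def using ab
    by (intro exI[of _ "a/2"] exI[of _ "b/2"]) (auto simp: joinpaths_def)
qed

lemma traverses_joinI2:
  assumes "traverses q g" "pathfinish p = pathstart q"
  shows "traverses (p +++ q) g"
proof -
  obtain a b where ab: "0 \<le> a" "a < b" "b \<le> 1" "q a = pathstart g" "q b = pathfinish g"
    "q ` {a..b} \<subseteq> path_image g" using assms unfolding traverses_def by blast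
  have eq: "(p +++ q) x = q (2 * x - 1)" if "x \<ge> 1/2" for x
  proof (cases "x = 1/2")
    case True
    show ?thesis unfolding True using assms(2) by (simp add: joinpaths_def pathstart_def pathfinish_def)
  next
    case False
    then show ?thesis using that by (simp add: joinpaths_def)
  qed
  have "(p +++ q) x \<in> path_image g" if "x \<in> {(a+1)/2..(b+1)/2}" for x
  proof -
    have "x \<ge> 1/2" "2 * x - 1 \<in> {a..b}" using that ab by auto
    then show ?thesis using eq ab(6) by auto
  qed
  moreover have "(p +++ q) ((a+1)/2) = q a" "(p +++ q) ((b+1)/2) = q b"
  proof -
    have h: "2 * ((c + 1) / 2) - 1 = c" for c :: real by (simp add: field_simps)
    show "(p +++ q) ((a+1)/2) = q a" "(p +++ q) ((b+1)/2) = q b"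
      using eq[of "(a+1)/2"] eq[of "(b+1)/2"] ab unfolding h by simp_all
  qed
  ultimately show ?thesis
    unfolding traverses_def using ab
    by (intro exI[of _ "(a+1)/2"] exI[of _ "(b+1)/2"]) auto
qed

text \<open>
  Each further path \<open>g l\<close> is inserted as a detour at the end: go from \<open>w\<close> to its start, follow it, and
  return to \<open>w\<close>.
\<close>

lemma path_connected_imp_path_traversing:
  fixes g :: "'i \<Rightarrow> real \<Rightarrow> 'a::topological_space"
  assumes "path_connected H" "finite L" "\<And>l. l \<in> L \<Longrightarrow> path (g l) \<and> path_image (g l) \<subseteq> H"
    and "v \<in> H" "w \<in> H"
  shows "\<exists>q. path q \<and> path_image q \<subseteq> H \<and> pathstart q = v \<and> pathfinish q = w \<and> (\<forall>l\<in>L. traverses q (g l))"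
  using assms(2,3)
proof (induction L rule: finite_induct)
  case empty
  then show ?case using assms(1,4,5) unfolding path_connected_def by blast
next
  case (insert l L)
  then obtain q where q: "path q" "path_image q \<subseteq> H" "pathstart q = v" "pathfinish q = w"
    "\<And>l. l \<in> L \<Longrightarrow> traverses q (g l)" by auto
  have g: "path (g l)" "path_image (g l) \<subseteq> H" using insert.prems by auto
  then have "pathstart (g l) \<in> H" "pathfinish (g l) \<in> H" by auto
  then obtain p p' where p: "path p" "path_image p \<subseteq> H" "pathstart p = w" "pathfinish p = pathstart (g l)"
    and p': "path p'" "path_image p' \<subseteq> H" "pathstart p' = pathfinish (g l)" "pathfinish p' = w"
    using assms(1,5) unfolding path_connected_def by metis
  show ?case
  proof (intro exI[of _ "q +++ p +++ g l +++ p'"] conjI ballI)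
    show "traverses (q +++ p +++ g l +++ p') (g k)" if "k \<in> insert l L" for k
    proof (cases "k = l")
      case True
      have "traverses (g l +++ p') (g l)" by (intro traverses_joinI1 traverses_self)
      then have "traverses (p +++ g l +++ p') (g l)" using p p' by (intro traverses_joinI2[of "g l +++ p'"]) auto
      then show ?thesis unfolding True using q p by (intro traverses_joinI2[of "p +++ g l +++ p'"]) auto
    next
      case False
      then show ?thesis using that q(5) by (intro traverses_joinI1) auto
    qed
  qed (use q p p' g in \<open>auto simp: path_image_join\<close>)
qed

text \<open>
  The set of points joined to \<open>x\<close> is a union of some of the paths, and so is its complement;
  being finite unions of compact sets, both are closed.
\<close>

lemma connected_finite_Union_paths_imp_path_connected:
  fixes g :: "'i \<Rightarrow> real \<Rightarrow> 'a::t2_space"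
  assumes "finite L" "\<And>l. l \<in> L \<Longrightarrow> path (g l)" "connected (\<Union>l\<in>L. path_image (g l))"
  shows "path_connected (\<Union>l\<in>L. path_image (g l))"
proof -
  let ?H = "\<Union>l\<in>L. path_image (g l)"
  have pc: "path_component ?H x y" if "l \<in> L" "x \<in> path_image (g l)" "y \<in> path_image (g l)" for l x y
  proof -
    have "path_component (path_image (g l)) x y"
      using path_connected_path_image[OF assms(2)[OF that(1)]] that(2,3)
      by (simp add: path_connected_component)
    then show ?thesis using that(1) by (meson UN_upper path_component_of_subset)
  qed
  have "path_component ?H x y" if xy: "x \<in> ?H" "y \<in> ?H" for x y
  proof (rule ccontr)
    assume ne: "\<not> path_component ?H x y"
    define A where "A = (\<Union>l\<in>{l\<in>L. \<exists>z\<in>path_image (g l). path_component ?H x z}. path_image (g l))"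
    define B where "B = (\<Union>l\<in>{l\<in>L. \<not> (\<exists>z\<in>path_image (g l). path_component ?H x z)}. path_image (g l))"
    have A: "path_component ?H x z" if "z \<in> A" for z
      using that pc unfolding A_def by (blast intro: path_component_trans)
    have B: "\<not> path_component ?H x z" if "z \<in> B" for z
      using that unfolding B_def by blast
    have "closed A" "closed B" unfolding A_def B_def using assms(1,2)
      by (auto intro!: closed_UN closed_path_image)
    moreover have AB: "A \<union> B = ?H" unfolding A_def B_def by blast
    moreover have "x \<in> A"
    proof -
      obtain l where "l \<in> L" "x \<in> path_image (g l)" using xy(1) by blast
      then show ?thesis using path_component_refl[OF xy(1)] unfolding A_def by blast
    qed
    moreover have "y \<in> B"
    proof (rule ccontr)
      assume "y \<notin> B"
      then have "y \<in> A" using AB xy(2) by blast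
      then show False using A ne by blast
    qed
    moreover have "A \<inter> B = {}" using A B by blast
    ultimately show False using assms(3) xy unfolding connected_closed by blast
  qed
  then show ?thesis by (simp add: path_connected_component)
qed

text \<open>
  Take for \<open>t'\<close> the first time with value at least \<open>b\<close>, and for \<open>s'\<close> the last time before \<open>t'\<close>
  with value at most \<open>a\<close>.
\<close>

lemma continuous_crossing:
  fixes u :: "real \<Rightarrow> real"
  assumes "s \<le> t" "continuous_on {s..t} u" "u s \<le> a" "a < b" "b \<le> u t"
  obtains s' t' where "s \<le> s'" "s' \<le> t'" "t' \<le> t" "u s' = a" "u t' = b"
    "\<And>x. x \<in> {s'..t'} \<Longrightarrow> a \<le> u x \<and> u x \<le> b"
proof -
  have cpt: "compact ({c..d} \<inter> u -` T)" if "continuous_on {c..d} u" "closed T" for c d T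
  proof -
    have "closed ({c..d} \<inter> u -` T)" using continuous_closed_preimage[OF that(1) _ that(2)] by simp
    then show ?thesis
      by (auto simp: compact_eq_bounded_closed intro: bounded_subset[OF bounded_closed_interval[of c d]])
  qed
  have "compact ({s..t} \<inter> u -` {b..})"
    by (rule cpt[OF assms(2) closed_atLeast])
  moreover have "t \<in> {s..t} \<inter> u -` {b..}" using assms by auto
  ultimately obtain t' where t': "t' \<in> {s..t} \<inter> u -` {b..}" "\<And>x. x \<in> {s..t} \<inter> u -` {b..} \<Longrightarrow> t' \<le> x"
    using compact_attains_inf[of "{s..t} \<inter> u -` {b..}"] by blast
  have c': "continuous_on {s..t'} u" using assms(2) t' by (auto intro: continuous_on_subset)
  have ut': "u t' = b"
  proof -
    obtain x where "s \<le> x" "x \<le> t'" "u x = b" using IVT'[of u s b t'] c' assms t' by auto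
    then show ?thesis using t'(1) t'(2)[of x] by (cases "x = t'") auto
  qed
  have "compact ({s..t'} \<inter> u -` {..a})"
    by (rule cpt[OF c' closed_atMost])
  moreover have "s \<in> {s..t'} \<inter> u -` {..a}" using assms t' by auto
  ultimately obtain s' where s': "s' \<in> {s..t'} \<inter> u -` {..a}" "\<And>x. x \<in> {s..t'} \<inter> u -` {..a} \<Longrightarrow> x \<le> s'"
    using compact_attains_sup[of "{s..t'} \<inter> u -` {..a}"] by blast
  have us': "u s' = a"
  proof -
    have "continuous_on {s'..t'} u" using c' s' by (auto intro: continuous_on_subset)
    then obtain x where "s' \<le> x" "x \<le> t'" "u x = a" using IVT'[of u s' a t'] assms s' ut' by auto
    then show ?thesis using s'(1) s'(2)[of x] by (cases "x = s'") auto
  qed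
  have "a \<le> u x \<and> u x \<le> b" if "x \<in> {s'..t'}" for x
  proof
    show "a \<le> u x"
    proof (rule ccontr)
      assume "\<not> a \<le> u x"
      then have "x \<in> {s..t'} \<inter> u -` {..a}" using that s'(1) by simp
      then have "x = s'" using s'(2) that by fastforce
      then show False using \<open>\<not> a \<le> u x\<close> us' by simp
    qed
    show "u x \<le> b"
    proof (rule ccontr)
      assume "\<not> u x \<le> b"
      then have "x \<in> {s..t} \<inter> u -` {b..}" using that s'(1) t'(1) by simp
      then have "x = t'" using t'(2) that by fastforce
      then show False using \<open>\<not> u x \<le> b\<close> ut' by simp
    qed
  qed
  then show ?thesis using that[of s' t'] s' t' us' ut' by auto
qed

text \<open>
  Tietze's theorem extends the inverse of \<open>g\<close>. Having the coordinate on the whole space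
  allows measuring paths that are only close to the arc.
\<close>

lemma arc_coordinate:
  fixes g :: "real \<Rightarrow> 'a::metric_space"
  assumes "arc g"
  obtains \<kappa> :: "'a \<Rightarrow> real" where "continuous_on UNIV \<kappa>" "\<And>t. t \<in> {0..1} \<Longrightarrow> \<kappa> (g t) = t"
proof -
  have g: "path g" "inj_on g {0..1}" using assms by (auto simp: arc_def)
  define f where "f = inv_into {0..1} g"
  have f: "f (g t) = t" if "t \<in> {0..1}" for t using g(2) that by (simp add: f_def)
  have "continuous_on (g ` {0..1}) f"
    by (rule continuous_on_inv) (use g f in \<open>auto simp: path_def\<close>)
  then have c: "continuous_map (subtopology euclidean (path_image g)) euclideanreal f"
    by (simp add: path_image_def)
  have im: "f ` path_image g \<subseteq> {0..1}" using f by (auto simp: path_image_def)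
  have cl: "closedin euclidean (path_image g)" using closed_path_image[OF g(1)] by simp
  have nrm: "normal_space (euclidean :: 'a topology)"
    by (rule metrizable_imp_normal_space[OF metrizable_space_euclidean])
  show ?thesis
  proof (rule Tietze_extension_closed_real_interval[OF nrm cl c im])
    fix \<kappa> assume \<kappa>: "continuous_map (euclidean :: 'a topology) euclideanreal \<kappa>"
      "\<And>x. x \<in> path_image g \<Longrightarrow> \<kappa> x = f x"
    show ?thesis
    proof (rule that)
      show "continuous_on UNIV \<kappa>" using \<kappa>(1) by simp
      show "\<kappa> (g t) = t" if "t \<in> {0..1}" for t
        using \<kappa>(2)[of "g t"] f[OF that] that by (simp add: path_image_def)
    qed
  qed simp
qed

lemma compact_closed_separated:
  fixes S T :: "'a::metric_space set"
  assumes "compact S" "closed T" "S \<inter> T = {}"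
  obtains d where "d > 0" "\<And>x y. \<lbrakk>x \<in> S; y \<in> T\<rbrakk> \<Longrightarrow> dist x y \<ge> d"
proof -
  have "\<And>x. x \<in> S \<Longrightarrow> x \<in> - T" using assms(3) by auto
  then obtain e where e: "0 < e" "\<And>x. x \<in> S \<Longrightarrow> \<exists>G\<in>{- T}. ball x e \<subseteq> G"
    using Heine_Borel_lemma[OF assms(1), of "{- T}"] assms(2) by (auto simp: subset_iff)
  show ?thesis
  proof (rule that[OF e(1)])
    fix x y assume "x \<in> S" "y \<in> T"
    then have "y \<notin> ball x e" using e(2)[of x] by (metis ComplD singletonD subsetD)
    then show "dist x y \<ge> e" by simp
  qed
qed

text \<open>
  Along \<open>h\<close> the coordinate \<open>\<kappa>\<close> passes from nearly 0 to nearly 1, so it crosses \<open>[1/3, 2/3]\<close>.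
  During this crossing \<open>h\<close> is close to points of the arc with coordinate in \<open>[1/4, 3/4]\<close>. These
  have positive distance from the rest \<open>R\<close> of the graph, which meets the arc only at its
  ends; hence \<open>h\<close> is on the arc.
\<close>

lemma robust_crossing:
  fixes g :: "real \<Rightarrow> 'a::metric_space"
  assumes "compact G" "arc g" "G = path_image g \<union> R" "closed R"
    "path_image g \<inter> R \<subseteq> {pathstart g, pathfinish g}"
    and \<kappa>: "continuous_on UNIV \<kappa>" "\<And>t. t \<in> {0..1} \<Longrightarrow> \<kappa> (g t) = t"
  obtains \<rho> where "\<rho> > 0"
    "\<And>p h (s::real) t. \<lbrakk>s \<le> t; continuous_on {s..t} h; h ` {s..t} \<subseteq> G; p ` {s..t} \<subseteq> path_image g;
        \<And>x. x \<in> {s..t} \<Longrightarrow> dist (h x) (p x) < \<rho>; p s = pathstart g; p t = pathfinish g\<rbrakk> \<Longrightarrow>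
      \<exists>s' t'. s \<le> s' \<and> s' \<le> t' \<and> t' \<le> t \<and> h ` {s'..t'} \<subseteq> path_image g \<and> \<kappa> (h s') = 1/3 \<and> \<kappa> (h t') = (2/3::real)"
proof -
  have "uniformly_continuous_on G \<kappa>"
    using compact_uniformly_continuous assms(1) \<kappa>(1) continuous_on_subset by blast
  \<comment> \<open>\<open>1/12\<close> is the margin between \<open>[1/3, 2/3]\<close> and \<open>[1/4, 3/4]\<close>\<close>
  then obtain \<rho>1 where \<rho>1: "\<rho>1 > 0" "\<And>x y. \<lbrakk>x \<in> G; y \<in> G; dist x y < \<rho>1\<rbrakk> \<Longrightarrow> \<bar>\<kappa> x - \<kappa> y\<bar> < 1/12"
    unfolding uniformly_continuous_on_def dist_real_def by (metis zero_less_divide_1_iff zero_less_numeral)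
  have g: "path g" "inj_on g {0..1}" using assms(2) by (auto simp: arc_def)
  have "continuous_on {1/4..3/4} g" using g(1) unfolding path_def by (rule continuous_on_subset) auto
  then have cpt: "compact (g ` {1/4..3/4})" by (rule compact_continuous_image) simp
  have "g ` {1/4..3/4} \<inter> R = {}"
  proof -
    have "g x \<notin> R" if x: "x \<in> {1/4..3/4}" for x
    proof
      assume "g x \<in> R"
      moreover have "g x \<in> path_image g" using x by (auto simp: path_image_def)
      ultimately have "g x = g 0 \<or> g x = g 1" using assms(5) by (auto simp: pathstart_def pathfinish_def)
      then have "\<kappa> (g x) = \<kappa> (g 0) \<or> \<kappa> (g x) = \<kappa> (g 1)" by auto
      then show False using x \<kappa>(2)[of x] \<kappa>(2)[of 0] \<kappa>(2)[of 1] by auto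
    qed
    then show ?thesis by auto
  qed
  then obtain \<rho>2 where \<rho>2: "\<rho>2 > 0" "\<And>x y. \<lbrakk>x \<in> g ` {1/4..3/4}; y \<in> R\<rbrakk> \<Longrightarrow> dist x y \<ge> \<rho>2"
    using compact_closed_separated[OF cpt assms(4)] by metis
  show ?thesis
  proof (rule that[of "min \<rho>1 \<rho>2"])
    show "min \<rho>1 \<rho>2 > 0" using \<rho>1 \<rho>2 by simp
    fix p h and s t :: real
    assume st: "s \<le> t" and h: "continuous_on {s..t} h" "h ` {s..t} \<subseteq> G" and p: "p ` {s..t} \<subseteq> path_image g"
      and hp: "\<And>x. x \<in> {s..t} \<Longrightarrow> dist (h x) (p x) < min \<rho>1 \<rho>2"
      and ends: "p s = pathstart g" "p t = pathfinish g"
    have near: "\<bar>\<kappa> (h x) - \<kappa> (p x)\<bar> < 1/12" if "x \<in> {s..t}" for x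
    proof (rule \<rho>1(2))
      show "h x \<in> G" using that h(2) by blast
      show "p x \<in> G" unfolding assms(3) using that p by blast
      show "dist (h x) (p x) < \<rho>1" using hp[OF that] by simp
    qed
    have "continuous_on {s..t} (\<lambda>x. \<kappa> (h x))"
      using continuous_on_compose2[OF \<kappa>(1) h(1)] by simp
    moreover have "\<kappa> (p s) = 0" "\<kappa> (p t) = 1" using ends \<kappa>(2)[of 0] \<kappa>(2)[of 1]
      by (auto simp: pathstart_def pathfinish_def)
    then have "\<kappa> (h s) \<le> 1/3" "\<kappa> (h t) \<ge> 2/3"
      using near[of s] near[of t] st unfolding atLeastAtMost_iff by linarith+
    ultimately obtain s' t' where st': "s \<le> s'" "s' \<le> t'" "t' \<le> t" "\<kappa> (h s') = 1/3" "\<kappa> (h t') = 2/3"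
      "\<And>x. x \<in> {s'..t'} \<Longrightarrow> 1/3 \<le> \<kappa> (h x) \<and> \<kappa> (h x) \<le> 2/3"
      using continuous_crossing[OF st, of "\<lambda>x. \<kappa> (h x)" "1/3" "2/3"] by auto
    have "h x \<in> path_image g" if x: "x \<in> {s'..t'}" for x
    proof -
      have xs: "x \<in> {s..t}" using x st' by auto
      then have "p x \<in> path_image g" using p by blast
      then obtain \<tau> where \<tau>: "\<tau> \<in> {0..1}" "p x = g \<tau>" unfolding path_image_def by blast
      have "\<bar>\<kappa> (h x) - \<tau>\<bar> < 1/12" using near[OF xs] \<tau> \<kappa>(2) by simp
      then have "\<tau> \<in> {1/4..3/4}" using st'(6)[OF x] unfolding atLeastAtMost_iff by linarith
      then have "\<rho>2 \<le> dist (p x) y" if "y \<in> R" for y using \<rho>2(2)[of "g \<tau>" y] that \<tau>(2) by auto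
      then have "h x \<notin> R" using hp[OF xs] by (force simp: dist_commute)
      moreover have "h x \<in> G" using h(2) xs by blast
      ultimately show ?thesis using assms(3) by blast
    qed
    then show "\<exists>s' t'. s \<le> s' \<and> s' \<le> t' \<and> t' \<le> t \<and> h ` {s'..t'} \<subseteq> path_image g \<and> \<kappa> (h s') = 1/3 \<and> \<kappa> (h t') = 2/3"
      using st' by blast
  qed
qed

lemma finite_uniform_positive:
  fixes \<rho> :: "'i \<Rightarrow> real"
  assumes "finite I" "\<And>i. i \<in> I \<Longrightarrow> \<rho> i > 0"
  obtains d where "d > 0" "\<And>i. i \<in> I \<Longrightarrow> d \<le> \<rho> i"
proof -
  have "\<exists>d>0. \<forall>i\<in>I. d \<le> \<rho> i" using assms
    by (intro exI[of _ "Min (insert 1 (\<rho> ` I))"]) auto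
  then show ?thesis using that by blast
qed

section \<open>Shadowing that survives perturbations\<close>

text \<open>
  This reparametrisation makes a map constant on the outer thirds of an arc, hence near the
  vertices of a graph.
\<close>

abbreviation middle_third :: "real \<Rightarrow> real"
  where "middle_third t \<equiv> max 0 (min 1 (3 * t - 1))"

lemma image_middle_third:
  assumes "\<And>t. t \<in> {0..1} \<Longrightarrow> F (g t) = q (middle_third t)"
  shows "F ` path_image g = path_image q"
proof
  show "F ` path_image g \<subseteq> path_image q"
    using assms by (auto simp: path_image_def)
  show "path_image q \<subseteq> F ` path_image g"
  proof
    fix x assume "x \<in> path_image q"
    then obtain t where t: "0 \<le> t" "t \<le> 1" "x = q t" by (auto simp: path_image_def)
    have third: "3 * ((1 + t) / 3) - 1 = t" by (simp add: field_simps)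
    have "x = F (g ((1 + t) / 3))" using t assms[of "(1+t)/3"] unfolding third by simp
    moreover have "g ((1 + t) / 3) \<in> path_image g" using t by (auto simp: path_image_def)
    ultimately show "x \<in> F ` path_image g" by blast
  qed
qed

text \<open>
  Shadowing at one precision \<open>\<epsilon>\<close> for all maps near \<open>f\<close>, with a common bound \<open>\<rho>\<close> for the perturbation
  and the jumps of the pseudo-orbits, so that it persists near \<open>f\<close>.
\<close>

definition robust_shadowing :: "'a::metric_space set \<Rightarrow> real \<Rightarrow> ('a \<Rightarrow> 'a) \<Rightarrow> bool"
  where "robust_shadowing X \<epsilon> f \<longleftrightarrow>
    (\<exists>\<rho>>0. \<forall>h. continuous_on X h \<and> h ` X \<subseteq> X \<and> (\<forall>x\<in>X. dist (h x) (f x) < \<rho>) \<longrightarrow>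
       (\<forall>\<xi>. pseudo_orbit X h \<rho> \<xi> \<longrightarrow> (\<exists>z\<in>X. \<forall>n. dist (\<xi> n) ((h ^^ n) z) < \<epsilon>)))"

text \<open>
  Here \<open>L i\<close> lists cells that are traversed by \<open>r \<circ> q i\<close> and cover its image. An itinerary exists since a
  point whose projection is close to the cell \<open>i\<close> is mapped by \<open>F \<circ> r\<close> into the image of \<open>q i\<close>: nearby
  points in other cells are close to a common vertex, where \<open>F\<close> is constant. So the projection of the
  next point of the pseudo-orbit is close to some cell in \<open>L i\<close>.

  The itinerary \<open>k\<close> is realised by a point of the arc \<open>p\<close> of cell \<open>k 0\<close>. If on some interval
  \<open>r \<circ> h\<^sup>n \<circ> p\<close> runs through the middle third of cell \<open>k n\<close>, then \<open>r \<circ> F \<circ> r \<circ> h\<^sup>n \<circ> p\<close>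
  performs the whole of \<open>r \<circ> q (k n)\<close> there, and in particular traverses cell \<open>k (n + 1)\<close>; by
  \<open>robust_crossing\<close> the nearby \<open>r \<circ> h\<^sup>n\<^sup>+\<^sup>1 \<circ> p\<close> runs through the middle third of that cell on a
  subinterval. The distance of the realising orbit from the pseudo-orbit is below \<open>4 * e\<close>: two
  applications of \<open>r\<close>, the diameter of a cell, and the distance from the cell.
\<close>

lemma robust_shadowing_traversing_map:
  fixes X :: "'a::metric_space set" and g :: "'i \<Rightarrow> real \<Rightarrow> 'a"
  assumes X: "compact X" and G: "compact G" "G \<subseteq> X" "G = (\<Union>i\<in>I. path_image (g i))"
    and I: "finite I" "\<And>i. i \<in> I \<Longrightarrow> arc (g i)"
    and meet: "\<And>i j. \<lbrakk>i \<in> I; j \<in> I; i \<noteq> j\<rbrakk> \<Longrightarrow>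
         path_image (g i) \<inter> path_image (g j) \<subseteq> {pathstart (g i), pathfinish (g i)}"
    and r: "continuous_on X r" "r ` X \<subseteq> G" "\<And>x. x \<in> G \<Longrightarrow> r x = x" "\<And>x. x \<in> X \<Longrightarrow> dist x (r x) < e"
    and mesh: "\<And>i x y. \<lbrakk>i \<in> I; x \<in> path_image (g i); y \<in> path_image (g i)\<rbrakk> \<Longrightarrow> dist x y \<le> e"
    and q: "\<And>i. i \<in> I \<Longrightarrow> path (q i) \<and> path_image (q i) \<subseteq> X"
    and L: "\<And>i. i \<in> I \<Longrightarrow> L i \<subseteq> I"
      "\<And>i. i \<in> I \<Longrightarrow> r ` path_image (q i) \<subseteq> (\<Union>l\<in>L i. path_image (g l))"
      "\<And>i l. \<lbrakk>i \<in> I; l \<in> L i\<rbrakk> \<Longrightarrow> traverses (r \<circ> q i) (g l)"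
    and F: "\<And>i t. \<lbrakk>i \<in> I; t \<in> {0..1}\<rbrakk> \<Longrightarrow> F (g i t) = q i (middle_third t)"
    and e: "4 * e \<le> \<epsilon>" "e > 0"
  shows "robust_shadowing X \<epsilon> (\<lambda>x. F (r x))"
proof -
  define E where "E i = path_image (g i)" for i
  have GE: "G = (\<Union>i\<in>I. E i)" unfolding E_def by (rule G(3))
  have EG: "E i \<subseteq> G" if "i \<in> I" for i using GE that by blast
  have clE: "closed (E i)" if "i \<in> I" for i unfolding E_def
    using I(2)[OF that] by (simp add: closed_path_image arc_imp_path)
  have "\<exists>\<kappa>. continuous_on UNIV \<kappa> \<and> (\<forall>t\<in>{0..1}. \<kappa> (g i t) = t)" if "i \<in> I" for i
    using arc_coordinate[OF I(2)[OF that]] by metis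
  then obtain \<kappa> where \<kappa>: "\<And>i. i \<in> I \<Longrightarrow> continuous_on UNIV (\<kappa> i)"
      "\<And>i t. i \<in> I \<Longrightarrow> t \<in> {0..1} \<Longrightarrow> \<kappa> i (g i t) = (t::real)" by metis
  define C where "C i \<rho> \<longleftrightarrow> (\<forall>p h (s::real) t. s \<le> t \<and> continuous_on {s..t} h \<and> h ` {s..t} \<subseteq> G \<and> p ` {s..t} \<subseteq> E i \<and>
        (\<forall>x\<in>{s..t}. dist (h x) (p x) < \<rho>) \<and> p s = pathstart (g i) \<and> p t = pathfinish (g i) \<longrightarrow>
      (\<exists>s' t'. s \<le> s' \<and> s' \<le> t' \<and> t' \<le> t \<and> h ` {s'..t'} \<subseteq> E i \<and> \<kappa> i (h s') = 1/3 \<and> \<kappa> i (h t') = 2/3))"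
    for i and \<rho> :: real
  have "\<exists>\<rho>>0. C i \<rho>" if iI: "i \<in> I" for i
  proof -
    let ?R = "\<Union>j\<in>I - {i}. E j"
    have 1: "G = path_image (g i) \<union> ?R" using GE iI E_def by auto
    have 2: "closed ?R" using I(1) clE by (intro closed_UN) auto
    have 3: "path_image (g i) \<inter> ?R \<subseteq> {pathstart (g i), pathfinish (g i)}"
      using meet[OF iI] unfolding E_def by blast
    show ?thesis
    proof (rule robust_crossing[OF G(1) I(2)[OF iI] 1 2 3 \<kappa>(1)[OF iI] \<kappa>(2)[OF iI]])
      fix \<rho> :: real
      assume *: "\<rho> > 0" "\<And>p h (s::real) t. \<lbrakk>s \<le> t; continuous_on {s..t} h; h ` {s..t} \<subseteq> G; p ` {s..t} \<subseteq> path_image (g i);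
        \<And>x. x \<in> {s..t} \<Longrightarrow> dist (h x) (p x) < \<rho>; p s = pathstart (g i); p t = pathfinish (g i)\<rbrakk> \<Longrightarrow>
      \<exists>s' t'. s \<le> s' \<and> s' \<le> t' \<and> t' \<le> t \<and> h ` {s'..t'} \<subseteq> path_image (g i) \<and> \<kappa> i (h s') = 1/3 \<and> \<kappa> i (h t') = 2/3"
      have "C i \<rho>" unfolding C_def E_def
      proof (intro allI impI, elim conjE)
        fix p h and s t :: real
        assume "s \<le> t" "continuous_on {s..t} h" "h ` {s..t} \<subseteq> G" "p ` {s..t} \<subseteq> path_image (g i)"
          "\<forall>x\<in>{s..t}. dist (h x) (p x) < \<rho>" "p s = pathstart (g i)" "p t = pathfinish (g i)"
        then show "\<exists>s' t'. s \<le> s' \<and> s' \<le> t' \<and> t' \<le> t \<and> h ` {s'..t'} \<subseteq> path_image (g i) \<and>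
            \<kappa> i (h s') = 1/3 \<and> \<kappa> i (h t') = 2/3" by (intro *(2)[of s t h p]) auto
      qed
      then show ?thesis using *(1) by blast
    qed
  qed
  then obtain \<rho>C where \<rho>C: "\<And>i. i \<in> I \<Longrightarrow> \<rho>C i > 0" "\<And>i. i \<in> I \<Longrightarrow> C i (\<rho>C i)" by metis
  obtain \<rho>0 where \<rho>0: "\<rho>0 > 0" "\<And>i. i \<in> I \<Longrightarrow> \<rho>0 \<le> \<rho>C i"
    using finite_uniform_positive[of I \<rho>C, OF I(1) \<rho>C(1)] by blast
  \<comment> \<open>points of another cell close to the cell \<open>i\<close> lie near a shared vertex, where \<open>F\<close> is constant\<close>
  have "\<exists>\<rho>>0. \<forall>x\<in>E i. \<forall>y\<in>E j. dist x y < \<rho> \<longrightarrow> F y \<in> F ` E i" if ij: "i \<in> I" "j \<in> I" for i j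
  proof (cases "i = j")
    case True
    then show ?thesis by (intro exI[of _ 1]) auto
  next
    case False
    \<comment> \<open>the parameters of \<open>g j\<close> outside the outer thirds at vertices on the cell \<open>i\<close>\<close>
    define T where "T = {1/3..2/3} \<union> (if g j 0 \<in> E i then {} else {0..1/3}) \<union> (if g j 1 \<in> E i then {} else {2/3..1::real})"
    have T: "compact T" "T \<subseteq> {0..1}" unfolding T_def by auto
    have "continuous_on T (g j)" using I(2)[OF ij(2)] T(2)
      by (metis arc_imp_path continuous_on_subset path_def)
    then have cT: "compact (g j ` T)" using T(1) by (rule compact_continuous_image)
    have inj: "inj_on (g j) {0..1}" using I(2)[OF ij(2)] by (simp add: arc_def)
    have "g j ` T \<inter> E i = {}"
    proof -
      have "g j t \<notin> E i" if t: "t \<in> T" for t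
      proof
        assume E: "g j t \<in> E i"
        have "t \<in> {0..1}" using t T by auto
        then have "g j t \<in> E j" by (auto simp: E_def path_image_def)
        then have "g j t \<in> {g j 0, g j 1}"
          using meet[OF ij(2) ij(1)] E False by (auto simp: E_def pathstart_def pathfinish_def)
        then have "t = 0 \<or> t = 1" using inj \<open>t \<in> {0..1}\<close> by (auto dest: inj_onD)
        then show False using t E by (auto simp: T_def split: if_splits)
      qed
      then show ?thesis by auto
    qed
    then obtain d where d: "d > 0" "\<And>x y. \<lbrakk>x \<in> g j ` T; y \<in> E i\<rbrakk> \<Longrightarrow> dist x y \<ge> d"
      using compact_closed_separated[OF cT clE[OF ij(1)]] by metis
    show ?thesis
    proof (intro exI[of _ d] conjI ballI impI d(1))
      fix x y assume xy: "x \<in> E i" "y \<in> E j" "dist x y < d"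
      obtain t where t: "t \<in> {0..1}" "y = g j t" using xy(2) by (auto simp: E_def path_image_def)
      have "t \<notin> T" using d(2)[of y x] xy t by (auto simp: dist_commute)
      then consider "t < 1/3" "g j 0 \<in> E i" | "t > 2/3" "g j 1 \<in> E i"
        using t(1) unfolding T_def by (fastforce split: if_splits)
      then show "F y \<in> F ` E i"
      proof cases
        case 1
        then have "F y = F (g j 0)" using F[OF ij(2) t(1)] F[OF ij(2), of 0] t by simp
        then show ?thesis using 1(2) by simp
      next
        case 2
        then have "F y = F (g j 1)" using F[OF ij(2) t(1)] F[OF ij(2), of 1] t by simp
        then show ?thesis using 2(2) by simp
      qed
    qed
  qed
  then obtain d where d: "\<And>i j. i \<in> I \<Longrightarrow> j \<in> I \<Longrightarrow> d i j > (0::real)"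
    "\<And>i j x y. \<lbrakk>i \<in> I; j \<in> I; x \<in> E i; y \<in> E j; dist x y < d i j\<rbrakk> \<Longrightarrow> F y \<in> F ` E i" by metis
  have "finite (I \<times> I)" using I(1) by simp
  moreover have "d (fst k) (snd k) > 0" if "k \<in> I \<times> I" for k using d(1) that by auto
  ultimately obtain \<rho>1' where \<rho>1': "\<rho>1' > 0" "\<And>k. k \<in> I \<times> I \<Longrightarrow> \<rho>1' \<le> d (fst k) (snd k)"
    using finite_uniform_positive[of "I \<times> I" "\<lambda>k. d (fst k) (snd k)"] by blast
  define \<rho>1 where "\<rho>1 = min \<rho>1' e"
  have \<rho>1: "\<rho>1 > 0" "\<rho>1 \<le> e" using \<rho>1' e by (auto simp: \<rho>1_def)
  have stay: "F y \<in> F ` E i" if "i \<in> I" "x \<in> E i" "y \<in> G" "dist x y < \<rho>1" for i x y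
  proof -
    obtain j where "j \<in> I" "y \<in> E j" using \<open>y \<in> G\<close> GE by auto
    then show ?thesis using d(2)[of i j x y] \<rho>1'(2)[of "(i,j)"] that by (simp add: \<rho>1_def)
  qed
  have third: "3 * ((1 + c) / 3) - 1 = c" for c :: real by (simp add: field_simps)
  have FE: "F ` E i = path_image (q i)" if "i \<in> I" for i
    unfolding E_def by (rule image_middle_third) (rule F[OF that])
  have "uniformly_continuous_on X r" using compact_uniformly_continuous r(1) X by blast
  moreover have "min \<rho>0 (\<rho>1/2) > 0" using \<rho>0(1) \<rho>1(1) by simp
  ultimately obtain \<rho> where \<rho>: "\<rho> > 0"
    "\<And>x y. \<lbrakk>x \<in> X; y \<in> X; dist x y < \<rho>\<rbrakk> \<Longrightarrow> dist (r x) (r y) < min \<rho>0 (\<rho>1/2)"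
    unfolding uniformly_continuous_on_def by metis
  show ?thesis
    unfolding robust_shadowing_def
  proof (intro exI[of _ \<rho>] conjI allI impI \<rho>(1))
    fix h \<xi> assume h: "continuous_on X h \<and> h ` X \<subseteq> X \<and> (\<forall>x\<in>X. dist (h x) (F (r x)) < \<rho>)"
      and "pseudo_orbit X h \<rho> \<xi>"
    then have \<xi>: "\<And>n. \<xi> n \<in> X" "\<And>n. dist (\<xi> (Suc n)) (h (\<xi> n)) < \<rho>"
      by (auto simp: pseudo_orbit_def)
    have hX: "h x \<in> X" if "x \<in> X" for x using h that by auto
    have FX: "F x \<in> X" if "x \<in> G" for x
    proof -
      obtain i where "i \<in> I" "x \<in> E i" using \<open>x \<in> G\<close> GE by auto
      then show ?thesis using FE[of i] q[of i] by blast
    qed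
    have rG: "r x \<in> G" if "x \<in> X" for x using r(2) that by auto
    have close: "dist (r (h x)) (r (F (r x))) < min \<rho>0 (\<rho>1/2)" if "x \<in> X" for x
      using \<rho>(2)[of "h x" "F (r x)"] hX[OF that] FX[OF rG[OF that]] h that by blast
    have "\<exists>k. \<forall>n. (k n \<in> I \<and> (\<exists>x\<in>E (k n). dist x (r (\<xi> n)) < \<rho>1)) \<and> k (Suc n) \<in> L (k n)"
    proof (rule dependent_nat_choice)
      obtain i where "i \<in> I" "r (\<xi> 0) \<in> E i" using rG[OF \<xi>(1)] GE by blast
      then show "\<exists>k. k \<in> I \<and> (\<exists>x\<in>E k. dist x (r (\<xi> 0)) < \<rho>1)"
        using \<rho>1(1) by (intro exI[of _ i]) (auto intro!: bexI[of _ "r (\<xi> 0)"])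
    next
      fix k n assume k: "k \<in> I \<and> (\<exists>x\<in>E k. dist x (r (\<xi> n)) < \<rho>1)"
      then have "F (r (\<xi> n)) \<in> path_image (q k)" using stay rG[OF \<xi>(1)] FE by blast
      then obtain l where l: "l \<in> L k" "r (F (r (\<xi> n))) \<in> E l" using L(2)[of k] k unfolding E_def by blast
      have "dist (r (h (\<xi> n))) (r (F (r (\<xi> n)))) < \<rho>1/2" using close[OF \<xi>(1)[of n]] by simp
      moreover have "dist (r (\<xi> (Suc n))) (r (h (\<xi> n))) < \<rho>1/2"
        using \<rho>(2)[OF \<xi>(1) hX[OF \<xi>(1)] \<xi>(2)[of n]] by simp
      ultimately have "dist (r (F (r (\<xi> n)))) (r (\<xi> (Suc n))) < \<rho>1"
        by (metis dist_commute dist_triangle_half_r)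
      then show "\<exists>l. (l \<in> I \<and> (\<exists>x\<in>E l. dist x (r (\<xi> (Suc n))) < \<rho>1)) \<and> l \<in> L k"
        using l L(1) k by blast
    qed
    then obtain k where k: "\<And>n. k n \<in> I" "\<And>n. \<exists>x\<in>E (k n). dist x (r (\<xi> n)) < \<rho>1"
      "\<And>n. k (Suc n) \<in> L (k n)" by blast
    define p where "p = g (k 0)"
    have hnX: "(h ^^ n) x \<in> X" if "x \<in> X" for n x using that hX by (induction n) auto
    have pX: "p x \<in> X" if "x \<in> {0..1}" for x
    proof -
      have "p x \<in> E (k 0)" using that by (auto simp: E_def p_def path_image_def)
      then show ?thesis using EG[OF k(1)[of 0]] G(2) by blast
    qed
    have cont: "continuous_on {0..1} (\<lambda>x. (h ^^ n) (p x))" for n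
    proof (induction n)
      case 0
      then show ?case using I(2)[OF k(1)[of 0]] arc_imp_path by (auto simp: p_def path_def)
    next
      case (Suc n)
      have "(\<lambda>x. (h ^^ n) (p x)) ` {0..1} \<subseteq> X" using pX hnX by blast
      then show ?case using continuous_on_compose2[of X h "{0..1}" "\<lambda>x. (h ^^ n) (p x)"] h Suc by simp
    qed
    have rcont: "continuous_on {0..1} (\<lambda>x. r ((h ^^ n) (p x)))" for n
      by (rule continuous_on_compose2[OF r(1) cont]) (use pX hnX in blast)
    \<comment> \<open>\<open>S n J\<close>: on \<open>J\<close> the projected \<open>n\<close>-th image of \<open>p\<close> runs through the middle third of the cell \<open>k n\<close>\<close>
    define S where "S n J \<longleftrightarrow> 0 \<le> fst J \<and> fst J \<le> snd J \<and> snd J \<le> 1 \<and>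
          (\<forall>x\<in>{fst J..snd J}. r ((h ^^ n) (p x)) \<in> E (k n)) \<and>
          \<kappa> (k n) (r ((h ^^ n) (p (fst J)))) = 1/3 \<and> \<kappa> (k n) (r ((h ^^ n) (p (snd J)))) = 2/3" for n J
    define T where "T J J' \<longleftrightarrow> fst J \<le> fst J' \<and> snd J' \<le> snd J" for J J' :: "real \<times> real"
    have "\<exists>J. \<forall>n. S n (J n) \<and> T (J n) (J (Suc n))"
    proof (rule dependent_nat_choice)
      have rp: "r (p t) = p t" if "t \<in> {0..1}" for t
        by (rule r(3), rule subsetD[OF EG[OF k(1)[of 0]]]) (use that in \<open>auto simp: p_def E_def path_image_def\<close>)
      have "\<kappa> (k 0) (r (p t)) = t" "r (p t) \<in> E (k 0)" if "t \<in> {0..1}" for t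
        using \<kappa>(2)[OF k(1)[of 0], of t] rp[of t] that by (auto simp: p_def E_def path_image_def)
      then have "S 0 (1/3, 2/3)" unfolding S_def by simp
      then show "\<exists>J. S 0 J" ..
    next
      fix J n
      assume J: "S n J"
      obtain s t where Jst: "J = (s, t)" by fastforce
      have st: "0 \<le> s" "s \<le> t" "t \<le> 1" "\<And>x. x \<in> {s..t} \<Longrightarrow> r ((h ^^ n) (p x)) \<in> E (k n)"
          "\<kappa> (k n) (r ((h ^^ n) (p s))) = 1/3" "\<kappa> (k n) (r ((h ^^ n) (p t))) = 2/3"
        using J unfolding S_def Jst fst_conv snd_conv by blast+
      let ?k = "k n" and ?l = "k (Suc n)"
      \<comment> \<open>\<open>[a, b]\<close> is the passage of \<open>q (k n)\<close> through the next cell; it occurs at coordinates \<open>(1+a)/3\<close> to \<open>(1+b)/3\<close>\<close>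
      obtain a b where ab: "0 \<le> a" "a < b" "b \<le> 1" "(r \<circ> q ?k) a = pathstart (g ?l)"
        "(r \<circ> q ?k) b = pathfinish (g ?l)" "(r \<circ> q ?k) ` {a..b} \<subseteq> path_image (g ?l)"
        using L(3)[OF k(1) k(3), of n] unfolding traverses_def by blast
      define u where "u x = \<kappa> ?k (r ((h ^^ n) (p x)))" for x
      have "continuous_on {s..t} u" unfolding u_def
        by (rule continuous_on_compose2[OF \<kappa>(1)[OF k(1)] continuous_on_subset[OF rcont]]) (use st in auto)
      then obtain s1 t1 where st1: "s \<le> s1" "s1 \<le> t1" "t1 \<le> t" "u s1 = (1+a)/3" "u t1 = (1+b)/3"
        "\<And>x. x \<in> {s1..t1} \<Longrightarrow> (1+a)/3 \<le> u x \<and> u x \<le> (1+b)/3"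
        using continuous_crossing[OF st(2), of u "(1+a)/3" "(1+b)/3"] st(5,6) ab by (auto simp: u_def)
      define v where "v x = r (q ?k (3 * u x - 1))" for x
      have Fv: "r (F (r ((h ^^ n) (p x)))) = v x" if "x \<in> {s1..t1}" for x
      proof -
        have "x \<in> {s..t}" using that st1 by auto
        then have "r ((h ^^ n) (p x)) \<in> g ?k ` {0..1}" using st(4) by (simp add: E_def path_image_def)
        then obtain \<tau> where \<tau>: "\<tau> \<in> {0..1}" "r ((h ^^ n) (p x)) = g ?k \<tau>" by blast
        then have "u x = \<tau>" using \<kappa>(2)[OF k(1)] by (simp add: u_def)
        moreover have "max 0 (min 1 (3 * u x - 1)) = 3 * u x - 1" using st1(6)[OF that] ab by auto
        ultimately show ?thesis using F[OF k(1) \<tau>(1)] \<tau>(2) by (simp add: v_def)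
      qed
      let ?h = "\<lambda>x. r ((h ^^ Suc n) (p x))"
      have "\<exists>s' t'. s1 \<le> s' \<and> s' \<le> t' \<and> t' \<le> t1 \<and> ?h ` {s'..t'} \<subseteq> E ?l \<and> \<kappa> ?l (?h s') = 1/3 \<and> \<kappa> ?l (?h t') = 2/3"
      proof (rule \<rho>C(2)[OF k(1), unfolded C_def, rule_format, of s1 t1 ?h v], intro conjI ballI)
        show "s1 \<le> t1" by (rule st1)
        show "continuous_on {s1..t1} ?h" using rcont[of "Suc n"] by (rule continuous_on_subset) (use st st1 in auto)
        show "?h ` {s1..t1} \<subseteq> G" using st st1 by (auto intro!: rG hnX pX hX)
        show "v ` {s1..t1} \<subseteq> E ?l"
        proof
          fix y assume "y \<in> v ` {s1..t1}"
          then obtain x where x: "x \<in> {s1..t1}" "y = v x" by blast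
          have "3 * u x - 1 \<in> {a..b}" using st1(6)[OF x(1)] by auto
          then show "y \<in> E ?l" using ab(6) x(2) by (auto simp: v_def E_def)
        qed
        show "dist (?h x) (v x) < \<rho>C ?l" if "x \<in> {s1..t1}" for x
        proof -
          have "(h ^^ n) (p x) \<in> X" using that st st1 by (intro hnX pX) auto
          from close[OF this] show ?thesis using Fv[OF that] \<rho>0(2)[OF k(1), of "Suc n"] by simp
        qed
        show "v s1 = pathstart (g ?l)" using ab(4) unfolding v_def st1(4) third by simp
        show "v t1 = pathfinish (g ?l)" using ab(5) unfolding v_def st1(5) third by simp
      qed
      then obtain s' t' where st': "s1 \<le> s'" "s' \<le> t'" "t' \<le> t1" "?h ` {s'..t'} \<subseteq> E ?l"
         "\<kappa> ?l (?h s') = 1/3" "\<kappa> ?l (?h t') = 2/3" by blast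
      have "S (Suc n) (s', t')"
        unfolding S_def fst_conv snd_conv
      proof (intro conjI ballI)
        show "0 \<le> s'" "s' \<le> t'" "t' \<le> 1"
          using st(1,3) st1(1,3) st'(1-3) by linarith+
        show "?h x \<in> E ?l" if "x \<in> {s'..t'}" for x using st'(4) that by blast
      qed (rule st'(5), rule st'(6))
      moreover have "T J (s', t')" using st1(1,3) st'(1,3) by (simp add: T_def Jst)
      ultimately show "\<exists>J'. S (Suc n) J' \<and> T J J'" by blast
    qed
    then obtain J where J: "\<And>n. S n (J n)" "\<And>n. T (J n) (J (Suc n))" by blast
    define K where "K n = {fst (J n)..snd (J n)}" for n
    have K1: "K n \<noteq> {}" "K n \<subseteq> {0..1}" "\<And>x. x \<in> K n \<Longrightarrow> r ((h ^^ n) (p x)) \<in> E (k n)" for n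
      using J(1)[of n] by (auto simp: K_def S_def)
    have "K (Suc n) \<subseteq> K n" for n using J(2)[of n] by (auto simp: K_def T_def)
    then have "K n \<subseteq> K m" if "m \<le> n" for m n using that by (rule lift_Suc_antimono_le)
    then have "\<Inter>(range K) \<noteq> {}" by (intro compact_nest K1(1)) (auto simp: K_def)
    then obtain c where c: "\<And>n. c \<in> K n" by blast
    show "\<exists>z\<in>X. \<forall>n. dist (\<xi> n) ((h ^^ n) z) < \<epsilon>"
    proof (intro bexI[of _ "p c"] allI)
      show pc: "p c \<in> X" using c[of 0] K1(2)[of 0] by (intro pX) auto
      fix n
      obtain x where x: "x \<in> E (k n)" "dist x (r (\<xi> n)) < \<rho>1" using k(2) by blast
      let ?z = "(h ^^ n) (p c)"
      have "dist x (r ?z) \<le> e" using mesh[OF k(1)] x(1) K1(3)[OF c] by (simp add: E_def)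
      moreover have "dist (\<xi> n) (r (\<xi> n)) < e" "dist ?z (r ?z) < e" using r(4) \<xi>(1) hnX[OF pc] by auto
      moreover have "dist (\<xi> n) ?z \<le> dist (\<xi> n) (r (\<xi> n)) + (dist (r (\<xi> n)) x + (dist x (r ?z) + dist (r ?z) ?z))"
        by (meson add_left_mono dist_triangle order_trans)
      ultimately show "dist (\<xi> n) ?z < \<epsilon>" using x(2) \<rho>1(2) e by (simp add: dist_commute)
    qed
  qed
qed

section \<open>Graphs and retractions onto them\<close>

lemma traverses_retract:
  assumes "traverses p g" "\<And>x. x \<in> path_image g \<Longrightarrow> r x = x"
  shows "traverses (r \<circ> p) g"
proof -
  obtain a b where ab: "0 \<le> a" "a < b" "b \<le> 1" "p a = pathstart g" "p b = pathfinish g"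
    "p ` {a..b} \<subseteq> path_image g" using assms(1) unfolding traverses_def by blast
  have "r (p x) = p x" if "x \<in> {a..b}" for x using assms(2) ab(6) that by blast
  then have "(r \<circ> p) ` {a..b} = p ` {a..b}" "(r \<circ> p) a = p a" "(r \<circ> p) b = p b"
    using ab(2) by auto
  then show ?thesis unfolding traverses_def using ab by metis
qed

text \<open>
  Cut each arc into \<open>N\<close> pieces of equal parameter length, where \<open>1/N\<close> is below a common modulus of uniform
  continuity. The piece \<open>(i, j)\<close> is the \<open>j\<close>-th one of the \<open>i\<close>-th arc. Two pieces of one arc share at most a
  division point, and pieces of different arcs can meet only at ends of these arcs, which are ends of pieces.
\<close>

lemma metric_graph_subdivision:
  fixes G :: "'a::metric_space set"
  assumes "metric_graph G" "e > 0"
  obtains I :: "(nat \<times> nat) set" and g where "finite I" "\<And>i. i \<in> I \<Longrightarrow> arc (g i)"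
    "G = (\<Union>i\<in>I. path_image (g i))"
    "\<And>i j. \<lbrakk>i \<in> I; j \<in> I; i \<noteq> j\<rbrakk> \<Longrightarrow>
       path_image (g i) \<inter> path_image (g j) \<subseteq> {pathstart (g i), pathfinish (g i)}"
    "\<And>i x y. \<lbrakk>i \<in> I; x \<in> path_image (g i); y \<in> path_image (g i)\<rbrakk> \<Longrightarrow> dist x y < e"
proof -
  obtain n :: nat and \<gamma> where \<gamma>: "\<And>i. i < n \<Longrightarrow> arc (\<gamma> i)" "G = (\<Union>i<n. path_image (\<gamma> i))"
    "\<And>i j. \<lbrakk>i < n; j < n; i \<noteq> j\<rbrakk> \<Longrightarrow> path_image (\<gamma> i) \<inter> path_image (\<gamma> j) \<subseteq> {pathstart (\<gamma> i), pathfinish (\<gamma> i)}"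
    using assms(1) unfolding metric_graph_def by blast
  have cont: "continuous_on {0..1} (\<gamma> i)" and inj: "inj_on (\<gamma> i) {0..1}" if "i < n" for i
    using \<gamma>(1)[OF that] by (auto simp: arc_def path_def)
  have "\<exists>d>0. \<forall>s\<in>{0..1}. \<forall>t\<in>{0..1}. dist s t < d \<longrightarrow> dist (\<gamma> i s) (\<gamma> i t) < e" if "i < n" for i
    using compact_uniformly_continuous[OF cont[OF that]] assms(2) unfolding uniformly_continuous_on_def
    by (meson compact_Icc)
  then obtain d where d: "\<And>i. i < n \<Longrightarrow> d i > 0"
    "\<And>i s t. \<lbrakk>i < n; s \<in> {0..1}; t \<in> {0..1}; dist s t < d i\<rbrakk> \<Longrightarrow> dist (\<gamma> i s) (\<gamma> i t) < e" by metis
  obtain d0 where d0: "d0 > 0" "\<And>i. i < n \<Longrightarrow> d0 \<le> d i"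
    using finite_uniform_positive[of "{..<n}" d] d(1) by auto
  obtain N0 where N0: "inverse (real (Suc N0)) < d0" using reals_Archimedean[OF d0(1)] by blast
  define N where "N = Suc N0"
  have N: "N > 0" "1 / real N < d0" using N0 by (auto simp: N_def inverse_eq_divide)
  define g where "g k t = \<gamma> (fst k) ((real (snd k) + t) / real N)" for k :: "nat \<times> nat" and t :: real
  define I where "I = {..<n} \<times> {..<N}"
  have Ik: "fst k < n" "snd k < N" if "k \<in> I" for k using that by (auto simp: I_def)
  have in01: "(real j + t) / real N \<in> {0..1}" if "j < N" "t \<in> {0..1}" for j t
  proof -
    have "real j + t \<le> real N" using that by (simp add: nat_less_real_le)
    then show ?thesis using that N by simp
  qed
  have ends: "t = 0 \<or> t = 1" if "i < n" "j < N" "t \<in> {0..1}" "\<gamma> i ((real j + t) / real N) \<in> {\<gamma> i 0, \<gamma> i 1}" for i j t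
  proof -
    have "(real j + t) / real N = 0 \<or> (real j + t) / real N = 1"
      using that(4) inj_onD[OF inj[OF that(1)] _ in01[OF that(2,3)]] by fastforce
    then have "real j + t = 0 \<or> real j + t = real N" using N by (auto simp: field_simps)
    then show ?thesis using that(2,3) by auto
  qed
  show ?thesis
  proof (rule that[of I g])
    show "finite I" by (simp add: I_def)
    show "arc (g k)" if "k \<in> I" for k
      unfolding arc_def path_def
    proof
      show "continuous_on {0..1} (g k)" unfolding g_def
        by (rule continuous_on_compose2[OF cont[OF Ik(1)[OF that]]])
          (use in01[OF Ik(2)[OF that]] N in \<open>auto intro!: continuous_intros\<close>)
      show "inj_on (g k) {0..1}"
      proof (rule inj_onI)
        fix s t :: real assume st: "s \<in> {0..1}" "t \<in> {0..1}" "g k s = g k t"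
        have "(real (snd k) + s) / real N = (real (snd k) + t) / real N"
          using inj_onD[OF inj[OF Ik(1)[OF that]] _ in01[OF Ik(2)[OF that] st(1)] in01[OF Ik(2)[OF that] st(2)]]
            st(3) by (simp add: g_def)
        then show "s = t" using N by simp
      qed
    qed
    show "G = (\<Union>i\<in>I. path_image (g i))"
    proof
      show "G \<subseteq> (\<Union>i\<in>I. path_image (g i))"
      proof
        fix x assume "x \<in> G"
        then obtain i t where it: "i < n" "t \<in> {0..1}" "x = \<gamma> i t" using \<gamma>(2) by (auto simp: path_image_def)
        \<comment> \<open>the end point of the arc belongs to its last piece\<close>
        define j where "j = (if t = 1 then N - 1 else nat \<lfloor>t * N\<rfloor>)"
        have "j < N \<and> t * N - j \<in> {0..1}"
        proof (cases "t = 1")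
          case True then show ?thesis using N by (auto simp: j_def)
        next
          case False
          then have "t * N < N" using it N by simp
          moreover have "0 \<le> t * N" using it by simp
          ultimately show ?thesis unfolding j_def using False by (auto simp: floor_less_iff) linarith+
        qed
        then have "x = g (i, j) (t * N - j)" "(i, j) \<in> I" "t * N - j \<in> {0..1}"
          using it N by (auto simp: g_def I_def)
        then show "x \<in> (\<Union>i\<in>I. path_image (g i))" unfolding path_image_def by blast
      qed
      show "(\<Union>i\<in>I. path_image (g i)) \<subseteq> G"
        unfolding \<gamma>(2) using in01 by (auto simp: path_image_def g_def I_def)
    qed
    show "path_image (g k) \<inter> path_image (g l) \<subseteq> {pathstart (g k), pathfinish (g k)}"
      if kl: "k \<in> I" "l \<in> I" "k \<noteq> l" for k l
    proof
      fix x assume "x \<in> path_image (g k) \<inter> path_image (g l)"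
      then obtain s t where st: "s \<in> {0..1}" "t \<in> {0..1}" "x = g k s" "x = g l t"
        by (auto simp: path_image_def)
      have "s = 0 \<or> s = 1"
      proof (cases "fst k = fst l")
        case True
        have "(real (snd k) + s) / real N = (real (snd l) + t) / real N"
          using inj_onD[OF inj[OF Ik(1)[OF kl(1)]] _ in01[OF Ik(2)[OF kl(1)] st(1)] in01[OF Ik(2)[OF kl(2)] st(2)]]
            st(3,4) True by (simp add: g_def)
        then have eq: "real (snd k) + s = real (snd l) + t" using N by simp
        have "snd k \<noteq> snd l" using True kl(3) by (simp add: prod_eq_iff)
        then consider "real (snd k) + 1 \<le> real (snd l)" | "real (snd l) + 1 \<le> real (snd k)" by linarith
        then show ?thesis
        proof cases
          case 1 then show ?thesis using eq st(1,2) by auto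
        next
          case 2 then show ?thesis using eq st(1,2) by auto
        qed
      next
        case False
        have "x \<in> path_image (\<gamma> (fst k)) \<inter> path_image (\<gamma> (fst l))"
          using in01[OF Ik(2)[OF kl(1)] st(1)] in01[OF Ik(2)[OF kl(2)] st(2)] st(3,4)
          unfolding path_image_def g_def by blast
        then have "\<gamma> (fst k) ((real (snd k) + s) / real N) \<in> {\<gamma> (fst k) 0, \<gamma> (fst k) 1}"
          using \<gamma>(3)[OF Ik(1)[OF kl(1)] Ik(1)[OF kl(2)] False] st(3)
          unfolding pathstart_def pathfinish_def g_def by blast
        then show ?thesis by (rule ends[OF Ik(1)[OF kl(1)] Ik(2)[OF kl(1)] st(1)])
      qed
      then show "x \<in> {pathstart (g k), pathfinish (g k)}" using st(3) by (auto simp: pathstart_def pathfinish_def)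
    qed
    show "dist x y < e" if k: "k \<in> I" "x \<in> path_image (g k)" "y \<in> path_image (g k)" for k x y
    proof -
      obtain s t where st: "s \<in> {0..1}" "t \<in> {0..1}" "x = g k s" "y = g k t"
        using k(2,3) by (auto simp: path_image_def)
      have "dist ((real (snd k) + s) / real N) ((real (snd k) + t) / real N) = \<bar>s - t\<bar> / real N"
        using N by (simp add: dist_real_def flip: diff_divide_distrib)
      also have "\<dots> \<le> 1 / real N" using st(1,2) by (intro divide_right_mono) auto
      also have "\<dots> < d (fst k)" using N d0(2)[OF Ik(1)[OF k(1)]] by linarith
      finally show ?thesis unfolding st(3,4) g_def
        by (rule d(2)[OF Ik(1)[OF k(1)] in01[OF Ik(2)[OF k(1)] st(1)] in01[OF Ik(2)[OF k(1)] st(2)]])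
    qed
  qed
qed

text \<open>
  Different arcs meet only at end points, and there the definitions agree with \<open>w\<close>.
\<close>

lemma map_on_graph_from_paths:
  fixes g :: "'i \<Rightarrow> real \<Rightarrow> 'a::metric_space" and q :: "'i \<Rightarrow> real \<Rightarrow> 'b::topological_space"
  assumes I: "finite I" "\<And>i. i \<in> I \<Longrightarrow> arc (g i)"
    and meet: "\<And>i j. \<lbrakk>i \<in> I; j \<in> I; i \<noteq> j\<rbrakk> \<Longrightarrow>
         path_image (g i) \<inter> path_image (g j) \<subseteq> {pathstart (g i), pathfinish (g i)}"
    and q: "\<And>i. i \<in> I \<Longrightarrow> path (q i)" "\<And>i. i \<in> I \<Longrightarrow> pathstart (q i) = w (pathstart (g i))"
      "\<And>i. i \<in> I \<Longrightarrow> pathfinish (q i) = w (pathfinish (g i))"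
  obtains F where "continuous_on (\<Union>i\<in>I. path_image (g i)) F"
    "\<And>i t. \<lbrakk>i \<in> I; t \<in> {0..1}\<rbrakk> \<Longrightarrow> F (g i t) = q i (middle_third t)"
proof -
  let ?G = "\<Union>i\<in>I. path_image (g i)"
  have "\<exists>\<kappa>. continuous_on UNIV \<kappa> \<and> (\<forall>t\<in>{0..1}. \<kappa> (g i t) = t)" if "i \<in> I" for i
    using arc_coordinate[OF I(2)[OF that]] by metis
  then obtain \<kappa> where \<kappa>: "\<And>i. i \<in> I \<Longrightarrow> continuous_on UNIV (\<kappa> i)"
      "\<And>i t. i \<in> I \<Longrightarrow> t \<in> {0..1} \<Longrightarrow> \<kappa> i (g i t) = (t::real)" by metis
  define f where "f i x = q i (max 0 (min 1 (3 * \<kappa> i x - 1)))" for i x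
  have fg: "f i (g i t) = q i (middle_third t)" if "i \<in> I" "t \<in> {0..1}" for i t
    using \<kappa>(2)[OF that] by (simp add: f_def)
  have fw: "f i x = w x" if "i \<in> I" "x \<in> {pathstart (g i), pathfinish (g i)}" for i x
    using fg[OF that(1), of 0] fg[OF that(1), of 1] q(2,3)[OF that(1)] that(2)
    by (auto simp: pathstart_def pathfinish_def)
  have cont: "continuous_on UNIV (f i)" if "i \<in> I" for i
  proof -
    have "continuous_on {0..1} (q i)" using q(1)[OF that] by (simp add: path_def)
    moreover have "continuous_on UNIV (\<lambda>x. max 0 (min 1 (3 * \<kappa> i x - 1)))"
      using \<kappa>(1)[OF that] by (intro continuous_intros)
    ultimately show ?thesis unfolding f_def by (rule continuous_on_compose2) auto
  qed
  define F where "F x = f (SOME i. i \<in> I \<and> x \<in> path_image (g i)) x" for x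
  have Ff: "F x = f i x" if "i \<in> I" "x \<in> path_image (g i)" for i x
  proof -
    define j where "j = (SOME i. i \<in> I \<and> x \<in> path_image (g i))"
    have j: "j \<in> I \<and> x \<in> path_image (g j)" unfolding j_def by (rule someI[of _ i]) (use that in blast)
    have "f j x = f i x"
    proof (cases "i = j")
      case False
      have "f i x = w x" using fw meet[of i j] that j False by blast
      moreover have "f j x = w x" using fw meet[of j i] that j False by blast
      ultimately show ?thesis by simp
    qed simp
    then show ?thesis by (simp add: F_def j_def)
  qed
  have "continuous_map (top_of_set ?G) euclidean F"
  proof (rule pasting_lemma_closed[OF I(1), where T = "\<lambda>i. path_image (g i)" and f = f])
    show "closedin (top_of_set ?G) (path_image (g i))" if "i \<in> I" for i
      using that I(2)[OF that] by (intro closed_subset) (auto simp: closed_path_image arc_imp_path)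
    show "continuous_map (subtopology (top_of_set ?G) (path_image (g i))) euclidean (f i)" if "i \<in> I" for i
      using cont[OF that] by (auto simp: subtopology_subtopology intro: continuous_on_subset)
    show "f i x = f j x" if "i \<in> I" "j \<in> I" "x \<in> topspace (top_of_set ?G) \<inter> path_image (g i) \<inter> path_image (g j)" for i j x
      using Ff[of i x] Ff[of j x] that by auto
    show "\<exists>j. j \<in> I \<and> x \<in> path_image (g j) \<and> F x = f j x" if "x \<in> topspace (top_of_set ?G)" for x
      using that Ff by auto
  qed
  then have "continuous_on ?G F" by simp
  moreover have "F (g i t) = q i (middle_third t)" if "i \<in> I" "t \<in> {0..1}" for i t
    using Ff[OF that(1), of "g i t"] fg[OF that] that(2) by (auto simp: path_image_def)
  ultimately show ?thesis using that by blast
qed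

text \<open>
  As \<open>r (r x) = r x\<close>, the points \<open>x\<close> and \<open>r x\<close> lie in the same fibre.
\<close>

lemma graphoid_retraction:
  fixes X :: "'a::metric_space set"
  assumes "graphoid X" "e > 0"
  obtains G r where "metric_graph G" "G \<subseteq> X" "retraction X G r" "\<And>x. x \<in> X \<Longrightarrow> dist x (r x) < e"
proof -
  obtain G r where G: "metric_graph G" "G \<subseteq> X" "retraction X G r" "\<forall>x\<in>G. diameter {y \<in> X. r y = x} < e"
    using assms unfolding graphoid_def by blast
  have "dist x (r x) < e" if "x \<in> X" for x
  proof -
    have rx: "r x \<in> G" "r (r x) = r x" using G(3) that unfolding retraction_def by auto
    have "bounded {y \<in> X. r y = r x}"
      by (rule bounded_subset[of X]) (use assms(1) in \<open>auto simp: graphoid_def compact_imp_bounded\<close>)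
    then have "dist x (r x) \<le> diameter {y \<in> X. r y = r x}"
      by (rule diameter_bounded_bound) (use that rx G(2) in auto)
    then show ?thesis using G(4) rx(1) by fastforce
  qed
  with G show ?thesis using that by blast
qed

section \<open>Approximation by robustly shadowing surjections\<close>

text \<open>
  The scales are chosen in the order \<open>\<eta>\<close>, \<open>\<eta>1\<close>, \<open>\<eta>0\<close>, \<open>\<delta>\<close>, \<open>e\<close>, and only then the graph. Connected sets
  around balls of radius \<open>\<eta>1\<close> have size \<open>\<eta>/4\<close>; loops of size \<open>\<eta>1\<close> fill balls of radius \<open>\<eta>0\<close>; \<open>e\<close> bounds both the
  displacement by the retraction and the diameter of the cells. The path for the cell \<open>i\<close> starts and ends at
  \<open>w = r \<circ> g\<close> of the ends of the cell, so that the paths fit together at the vertices. It takes the loop first, and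
  then traverses the subgraph \<open>H\<close> of all cells meeting \<open>r ` V\<close>. The loop lies in \<open>V\<close>, so its projection
  meets only cells that are traversed later.
\<close>

lemma dense_robust_shadowing:
  fixes X :: "'a::metric_space set"
  assumes "graphite X" and g: "continuous_on X g" "g ` X = X" and pos: "\<epsilon> > 0" "\<eta> > 0"
  shows "\<exists>f. continuous_on X f \<and> f ` X = X \<and> (\<forall>x\<in>X. dist (f x) (g x) < \<eta>) \<and>
     robust_shadowing X \<epsilon> f"
proof -
  have X: "compact X" "locally connected X" "graphoid X"
    using assms(1) by (auto simp: graphite_def graphoid_def)
  have "\<eta>/4 > 0" using pos by simp
  from uniformly_locally_connected[OF X(1,2) this] obtain \<eta>1 where \<eta>1: "\<eta>1 > 0"
    "\<And>b. b \<in> X \<Longrightarrow> \<exists>V. connected V \<and> V \<subseteq> X \<inter> ball b (\<eta>/4) \<and> X \<inter> ball b \<eta>1 \<subseteq> V" by metis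
  from local_Hahn_Mazurkiewicz[OF X(1,2) \<eta>1(1)] obtain \<eta>0 where \<eta>0: "\<eta>0 > 0"
    "\<And>b. b \<in> X \<Longrightarrow> \<exists>c. path c \<and> pathstart c = b \<and> pathfinish c = b \<and>
        path_image c \<subseteq> X \<inter> ball b \<eta>1 \<and> X \<inter> ball b \<eta>0 \<subseteq> path_image c" by metis
  define \<tau> where "\<tau> = min \<eta>0 (min \<eta>1 \<eta>) / 8"
  have \<tau>: "\<tau> > 0" "8 * \<tau> \<le> \<eta>0" "8 * \<tau> \<le> \<eta>1" "8 * \<tau> \<le> \<eta>"
    using pos \<eta>0(1) \<eta>1(1) by (auto simp: \<tau>_def)
  obtain \<delta> where \<delta>: "\<delta> > 0" "\<And>x y. \<lbrakk>x \<in> X; y \<in> X; dist x y < \<delta>\<rbrakk> \<Longrightarrow> dist (g x) (g y) < \<tau>"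
    using compact_uniformly_continuous[OF g(1) X(1)] \<tau>(1) unfolding uniformly_continuous_on_def by metis
  define e where "e = min (\<epsilon>/4) (min (\<delta>/2) \<tau>)"
  have e: "e > 0" "4 * e \<le> \<epsilon>" "2 * e \<le> \<delta>" "e \<le> \<tau>" using pos \<delta>(1) \<tau>(1) by (auto simp: e_def)
  obtain G r where G: "metric_graph G" "G \<subseteq> X" "retraction X G r" "\<And>x. x \<in> X \<Longrightarrow> dist x (r x) < e"
    using graphoid_retraction[OF X(3) e(1)] by blast
  have r: "continuous_on X r" "r ` X \<subseteq> G" "\<And>x. x \<in> G \<Longrightarrow> r x = x"
    using G(3) unfolding retraction_def by auto
  have rG: "r x \<in> G" "r x \<in> X" if "x \<in> X" for x using r(2) G(2) that by auto
  have cG: "compact G" using G(1) unfolding metric_graph_def by blast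
  obtain I :: "(nat \<times> nat) set" and \<gamma> where I: "finite I" "\<And>i. i \<in> I \<Longrightarrow> arc (\<gamma> i)"
    "G = (\<Union>i\<in>I. path_image (\<gamma> i))"
    and meet: "\<And>i j. \<lbrakk>i \<in> I; j \<in> I; i \<noteq> j\<rbrakk> \<Longrightarrow>
       path_image (\<gamma> i) \<inter> path_image (\<gamma> j) \<subseteq> {pathstart (\<gamma> i), pathfinish (\<gamma> i)}"
    and mesh: "\<And>i x y. \<lbrakk>i \<in> I; x \<in> path_image (\<gamma> i); y \<in> path_image (\<gamma> i)\<rbrakk> \<Longrightarrow> dist x y < e"
    using metric_graph_subdivision[OF G(1) e(1)] by metis
  define E where "E i = path_image (\<gamma> i)" for i
  have EG: "E i \<subseteq> G" if "i \<in> I" for i using I(3) that by (auto simp: E_def)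
  have gX: "g x \<in> X" if "x \<in> X" for x using g(2) that by blast
  define w where "w x = r (g x)" for x
  define b where "b i = w (pathstart (\<gamma> i))" for i
  define c where "c i = w (pathfinish (\<gamma> i))" for i
  have endsE: "pathstart (\<gamma> i) \<in> E i" "pathfinish (\<gamma> i) \<in> E i" for i by (auto simp: E_def)
  have EX: "x \<in> X" if "i \<in> I" "x \<in> E i" for i x using EG that G(2) by blast
  have bX: "b i \<in> X" "b i \<in> G" "c i \<in> X" "c i \<in> G" if "i \<in> I" for i
    unfolding b_def c_def w_def using rG gX EX[OF that] endsE by auto
  have gb: "dist (g x) (b i) < 2 * \<tau>" if "i \<in> I" "x \<in> X" "r x \<in> E i" for i x
  proof -
    let ?v = "pathstart (\<gamma> i)"
    have v: "?v \<in> X" using EX[OF that(1)] endsE by auto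
    have "dist (r x) ?v < e" using mesh[OF that(1)] that(3) endsE(1)[of i] by (auto simp: E_def)
    then have "dist x ?v < \<delta>" using G(4)[OF that(2)] dist_triangle[of x ?v "r x"] e(3) by linarith
    then have "dist (g x) (g ?v) < \<tau>" using \<delta>(2)[OF that(2) v] by simp
    moreover have "dist (g ?v) (b i) < e" unfolding b_def w_def by (rule G(4)[OF gX[OF v]])
    ultimately show ?thesis using dist_triangle[of "g x" "b i" "g ?v"] e(4) by linarith
  qed
  have cb: "dist (c i) (b i) < 3 * \<tau>" if "i \<in> I" for i
  proof -
    let ?v = "pathfinish (\<gamma> i)"
    have v: "?v \<in> X" "?v \<in> G" using EX[OF that] subsetD[OF EG[OF that]] endsE by blast+
    have "dist (g ?v) (b i) < 2 * \<tau>" by (rule gb[OF that v(1)]) (use r(3)[OF v(2)] endsE in auto)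
    moreover have "dist (g ?v) (c i) < e" unfolding c_def w_def by (rule G(4)[OF gX[OF v(1)]])
    ultimately show ?thesis using dist_triangle3[of "c i" "b i" "g ?v"] e(4) by linarith
  qed
  define A where "A i q L \<longleftrightarrow> path q \<and> path_image q \<subseteq> X \<and> pathstart q = b i \<and> pathfinish q = c i \<and>
      X \<inter> ball (b i) \<eta>0 \<subseteq> path_image q \<and> (\<forall>y\<in>path_image q. dist y (b i) < \<eta>/4 + 2 * e) \<and>
      L \<subseteq> I \<and> r ` path_image q \<subseteq> (\<Union>l\<in>L. E l) \<and> (\<forall>l\<in>L. traverses (r \<circ> q) (\<gamma> l))" for i q L
  have "\<exists>q L. A i q L" if i: "i \<in> I" for i
  proof -
    obtain V where V: "connected V" "V \<subseteq> X \<inter> ball (b i) (\<eta>/4)" "X \<inter> ball (b i) \<eta>1 \<subseteq> V"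
      using \<eta>1(2)[OF bX(1)[OF i]] by blast
    obtain p where p: "path p" "pathstart p = b i" "pathfinish p = b i"
        "path_image p \<subseteq> X \<inter> ball (b i) \<eta>1" "X \<inter> ball (b i) \<eta>0 \<subseteq> path_image p"
      using \<eta>0(2)[OF bX(1)[OF i]] by blast
    define L where "L = {l \<in> I. E l \<inter> r ` V \<noteq> {}}"
    define H where "H = (\<Union>l\<in>L. E l)"
    have L: "finite L" "L \<subseteq> I" using I(1) by (auto simp: L_def)
    have VX: "V \<subseteq> X" using V(2) by blast
    have rV: "r ` V \<subseteq> H"
    proof
      fix y assume y: "y \<in> r ` V"
      then have "y \<in> G" using rG VX by blast
      then obtain l where "l \<in> I" "y \<in> E l" using I(3) unfolding E_def by blast
      then show "y \<in> H" using y unfolding H_def L_def by blast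
    qed
    have bV: "b i \<in> V" using V(3) bX[OF i] \<eta>1(1) by auto
    have cV: "c i \<in> V" using V(3) bX[OF i] cb[OF i] \<tau> by (auto simp: dist_commute)
    have bH: "b i \<in> r ` V" "c i \<in> r ` V" using bV cV r(3) bX[OF i] by (metis imageI)+
    \<comment> \<open>\<open>H\<close> is connected as a union of arcs that all meet the connected set \<open>r ` V\<close>\<close>
    have "connected (\<Union>l\<in>L. E l \<union> r ` V)"
    proof (rule connected_Union)
      have crV: "connected (r ` V)"
        by (rule connected_continuous_image[OF continuous_on_subset[OF r(1) VX] V(1)])
      show "connected S" if "S \<in> (\<lambda>l. E l \<union> r ` V) ` L" for S
      proof -
        obtain l where l: "l \<in> L" "S = E l \<union> r ` V" using \<open>S \<in> _\<close> by blast
        have "connected (E l)" using I(2)[of l] l L(2) unfolding E_def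
          by (meson arc_imp_path connected_path_image subsetD)
        then show ?thesis unfolding l(2) using l(1) crV by (intro connected_Un) (auto simp: L_def)
      qed
      show "\<Inter> ((\<lambda>l. E l \<union> r ` V) ` L) \<noteq> {}" using bH by blast
    qed
    moreover have "(\<Union>l\<in>L. E l \<union> r ` V) = H" using rV bH unfolding H_def by blast
    ultimately have "connected H" by simp
    then have pc: "path_connected H" unfolding H_def E_def
      by (intro connected_finite_Union_paths_imp_path_connected)
        (use L(1) arc_imp_path[OF I(2)[OF subsetD[OF L(2)]]] in blast)+
    have \<gamma>H: "path (\<gamma> l) \<and> path_image (\<gamma> l) \<subseteq> H" if "l \<in> L" for l
      using arc_imp_path[OF I(2)[OF subsetD[OF L(2) that]]] that unfolding H_def E_def by blast
    have "b i \<in> H" "c i \<in> H" using bH rV by blast+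
    from path_connected_imp_path_traversing[of H L \<gamma>, OF pc L(1) \<gamma>H this]
    obtain q where q: "path q" "path_image q \<subseteq> H" "pathstart q = b i" "pathfinish q = c i"
      "\<And>l. l \<in> L \<Longrightarrow> traverses q (\<gamma> l)" by blast
    have HG: "H \<subseteq> G" unfolding H_def using L(2) EG by blast
    have pV: "path_image p \<subseteq> V" using p(4) V(3) by blast
    have pq: "path_image (p +++ q) = path_image p \<union> path_image q"
      using p(3) q(3) by (simp add: path_image_join)
    have "A i (p +++ q) L"
      unfolding A_def
    proof (intro conjI ballI)
      show "path (p +++ q)" using p q by simp
      show "path_image (p +++ q) \<subseteq> X" unfolding pq using pV VX q(2) HG G(2) by blast
      show "pathstart (p +++ q) = b i" "pathfinish (p +++ q) = c i" using p q by auto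
      show "X \<inter> ball (b i) \<eta>0 \<subseteq> path_image (p +++ q)" unfolding pq using p(5) by blast
      show "L \<subseteq> I" by (rule L)
      show "r ` path_image (p +++ q) \<subseteq> (\<Union>l\<in>L. E l)"
      proof -
        have "r ` path_image p \<subseteq> H" using pV rV by blast
        moreover have "r y \<in> H" if "y \<in> path_image q" for y
        proof -
          have "y \<in> H" using that q(2) by blast
          then show ?thesis using r(3)[of y] HG by auto
        qed
        ultimately show ?thesis unfolding pq H_def by blast
      qed
      show "traverses (r \<circ> (p +++ q)) (\<gamma> l)" if "l \<in> L" for l
      proof (rule traverses_retract)
        show "traverses (p +++ q) (\<gamma> l)" using q(5)[OF that] p(3) q(3) by (intro traverses_joinI2) auto
        show "r x = x" if "x \<in> path_image (\<gamma> l)" for x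
          using r(3) EG[of l] L(2) \<open>l \<in> L\<close> that unfolding E_def by blast
      qed
      fix y assume "y \<in> path_image (p +++ q)"
      then consider "y \<in> V" | "y \<in> H" using pq pV q(2) by blast
      then show "dist y (b i) < \<eta>/4 + 2 * e"
      proof cases
        case 1
        then have "dist y (b i) < \<eta>/4" using V(2) by (auto simp: dist_commute)
        then show ?thesis using e(1) by linarith
      next
        case 2
        then obtain l v where l: "l \<in> I" "y \<in> E l" "v \<in> V" "r v \<in> E l" unfolding H_def L_def by blast
        have "dist y (r v) < e" using mesh[OF l(1)] l(2,4) by (simp add: E_def)
        moreover have "dist (r v) v < e" using G(4)[of v] VX l(3) by (auto simp: dist_commute)
        moreover have "dist v (b i) < \<eta>/4" using V(2) l(3) by (auto simp: dist_commute)
        ultimately show ?thesis using dist_triangle[of y "b i" "r v"] dist_triangle[of "r v" "b i" v] by linarith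
      qed
    qed
    then show ?thesis by blast
  qed
  then obtain q L where "\<And>i. i \<in> I \<Longrightarrow> A i (q i) (L i)" by metis
  then have q: "path (q i)" "path_image (q i) \<subseteq> X" "pathstart (q i) = b i" "pathfinish (q i) = c i"
      "X \<inter> ball (b i) \<eta>0 \<subseteq> path_image (q i)" "y \<in> path_image (q i) \<Longrightarrow> dist y (b i) < \<eta>/4 + 2 * e"
      and L: "L i \<subseteq> I" "r ` path_image (q i) \<subseteq> (\<Union>l\<in>L i. path_image (\<gamma> l))"
      "l \<in> L i \<Longrightarrow> traverses (r \<circ> q i) (\<gamma> l)" if "i \<in> I" for i y l
    using that unfolding A_def E_def by blast+
  have qw: "pathstart (q i) = w (pathstart (\<gamma> i))" "pathfinish (q i) = w (pathfinish (\<gamma> i))" if "i \<in> I" for i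
    using q(3,4)[OF that] by (simp_all add: b_def c_def)
  obtain F where F: "continuous_on G F"
    "\<And>i t. \<lbrakk>i \<in> I; t \<in> {0..1}\<rbrakk> \<Longrightarrow> F (\<gamma> i t) = q i (middle_third t)"
    using map_on_graph_from_paths[where I = I and g = \<gamma> and q = q and w = w, OF I(1,2) meet q(1) qw]
    unfolding I(3)[symmetric] by blast
  have FE: "F ` E i = path_image (q i)" if "i \<in> I" for i
    unfolding E_def by (rule image_middle_third) (rule F(2)[OF that])
  have cell: "\<exists>i\<in>I. r x \<in> E i" if "x \<in> X" for x using rG(1)[OF that] I(3) by (auto simp: E_def)
  have Frq: "\<exists>i\<in>I. r x \<in> E i \<and> F (r x) \<in> path_image (q i)" if "x \<in> X" for x
    using cell[OF that] FE by blast
  show ?thesis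
  proof (intro exI[of _ "\<lambda>x. F (r x)"] conjI)
    show "continuous_on X (\<lambda>x. F (r x))" by (rule continuous_on_compose2[OF F(1) r(1,2)])
    show "(\<lambda>x. F (r x)) ` X = X"
    proof
      show "(\<lambda>x. F (r x)) ` X \<subseteq> X" using Frq q(2) by blast
      show "X \<subseteq> (\<lambda>x. F (r x)) ` X"
      proof
        fix y assume y: "y \<in> X"
        then obtain x where x: "x \<in> X" "y = g x" using g(2) by blast
        obtain i where i: "i \<in> I" "r x \<in> E i" using cell[OF x(1)] by blast
        have "dist (b i) y < \<eta>0" using gb[OF i(1) x(1) i(2)] \<tau> by (simp add: x(2) dist_commute)
        then have "y \<in> F ` E i" using q(5)[OF i(1)] FE[OF i(1)] y by auto
        then obtain z where z: "z \<in> E i" "y = F z" by blast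
        then have "z \<in> X" "r z = z" using EX[OF i(1)] EG[OF i(1)] r(3) by auto
        then show "y \<in> (\<lambda>x. F (r x)) ` X" using z(2) by (metis imageI)
      qed
    qed
    show "\<forall>x\<in>X. dist (F (r x)) (g x) < \<eta>"
    proof
      fix x assume x: "x \<in> X"
      then obtain i where i: "i \<in> I" "r x \<in> E i" "F (r x) \<in> path_image (q i)" using Frq by blast
      have "dist (F (r x)) (b i) < \<eta>/4 + 2 * e" by (rule q(6)[OF i(1,3)])
      moreover have "dist (g x) (b i) < 2 * \<tau>" by (rule gb[OF i(1) x i(2)])
      ultimately show "dist (F (r x)) (g x) < \<eta>"
        using dist_triangle2[of "F (r x)" "g x" "b i"] e(4) \<tau> pos by linarith
    qed
    show "robust_shadowing X \<epsilon> (\<lambda>x. F (r x))"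
    proof (rule robust_shadowing_traversing_map[where L = L and q = q, OF X(1) cG G(2) I(3) I(1,2) meet r G(4)])
      show "path (q i) \<and> path_image (q i) \<subseteq> X" if "i \<in> I" for i using q(1,2)[OF that] by blast
      show "dist x y \<le> e" if "i \<in> I" "x \<in> path_image (\<gamma> i)" "y \<in> path_image (\<gamma> i)" for i x y
        using mesh[OF that] by simp
    qed (assumption | rule L F(2) e)+
  qed
qed

section \<open>Genericity among surjections\<close>

lemma mspace_sspace:
  assumes "compact X"
  shows "mspace (sspace X) = {f \<in> X \<rightarrow>\<^sub>E X. continuous_on X f \<and> f ` X = X}"
  using assms by (auto simp: sspace_def mspace_cspace)

lemma mdist_cspace_less_iff:
  assumes "compact X" "X \<noteq> {}" "f \<in> mspace (cspace X)" "g \<in> mspace (cspace X)"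
  shows "mdist (cspace X) f g < r \<longleftrightarrow> (\<forall>x\<in>X. dist (f x) (g x) < r)"
proof
  assume "mdist (cspace X) f g < r"
  moreover have "dist (f x) (g x) \<le> mdist (cspace X) f g" if "x \<in> X" for x
    using mdist_cfunspace_imp_mdist_le[of f "top_of_set X" "submetric euclidean_metric X" g] assms(3,4) that
    by (auto simp: cspace_def)
  ultimately show "\<forall>x\<in>X. dist (f x) (g x) < r" by fastforce
next
  assume "\<forall>x\<in>X. dist (f x) (g x) < r"
  then show "mdist (cspace X) f g < r" using mdist_cspace(2)[OF assms] by auto
qed

text \<open>
  The surjections form a closed subset of the complete space of all continuous self-maps: the image of a uniform
  limit of surjections is dense and compact.
\<close>

lemma completely_metrizable_sspace:
  fixes X :: "'a::metric_space set"
  assumes "compact X" "X \<noteq> {}"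
  shows "completely_metrizable_space (mtopology_of (sspace X))"
proof -
  let ?C = "cspace X"
  interpret C: Metric_space "mspace ?C" "mdist ?C" by (rule Metric_space_mspace_mdist)
  have top: "mtopology_of ?C = C.mtopology" by (simp add: mtopology_of_def)
  let ?E = "submetric euclidean_metric X"
  interpret E: Metric_space "mspace ?E" "mdist ?E" by (rule Metric_space_mspace_mdist)
  have "E.mtopology = top_of_set X"
    using mtopology_of_submetric_euclidean[of X] by (simp add: mtopology_of_def)
  then have "compact_space E.mtopology" using assms(1) by (simp add: compact_space_subtopology)
  then have "mcomplete_of (cfunspace (top_of_set X) E.Self)"
    by (intro E.mcomplete_cfunspace E.compact_space_imp_mcomplete)
  moreover have "E.Self = ?E"
  proof -
    have "E.Self = metric (mspace ?E, mdist ?E)" unfolding E.Self_def by (rule refl)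
    also have "\<dots> = ?E" by (simp, simp add: submetric_def)
    finally show ?thesis .
  qed
  ultimately have "mcomplete_of ?C" by (simp add: cspace_def)
  then have cm: "completely_metrizable_space (mtopology_of ?C)"
    unfolding top mcomplete_of_def by (rule C.completely_metrizable_space_mtopology)
  let ?S = "{f \<in> mspace ?C. f ` X = X}"
  have "C.mtopology closure_of ?S \<subseteq> ?S"
  proof
    fix f assume f: "f \<in> C.mtopology closure_of ?S"
    then have fC: "f \<in> mspace ?C" and appr: "\<And>r. r > 0 \<Longrightarrow> \<exists>h\<in>?S. h \<in> C.mball f r"
      by (auto simp: C.metric_closure_of)
    have cf: "continuous_on X f" "f ` X \<subseteq> X" using fC assms(1) by (auto simp: mspace_cspace)
    have "y \<in> closure (f ` X)" if "y \<in> X" for y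
      unfolding closure_approachable
    proof (intro allI impI)
      fix r :: real assume "r > 0"
      then obtain h where h: "h \<in> mspace ?C" "h ` X = X" "mdist ?C f h < r" using appr[OF \<open>r > 0\<close>] by auto
      then obtain x where "x \<in> X" "y = h x" using \<open>y \<in> X\<close> by blast
      then show "\<exists>z\<in>f ` X. dist z y < r" using mdist_cspace_less_iff[OF assms fC h(1)] h(3) by auto
    qed
    moreover have "closed (f ` X)"
      using compact_continuous_image[OF cf(1) assms(1)] by (rule compact_imp_closed)
    ultimately show "f \<in> ?S" using fC cf(2) by auto
  qed
  then have "closedin (mtopology_of ?C) ?S"
    unfolding top by (subst closure_of_subset_eq[symmetric]) auto
  then have "completely_metrizable_space (subtopology (mtopology_of ?C) ?S)"
    by (rule completely_metrizable_space_closedin[OF cm])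
  moreover have "?S = topspace (mtopology_of ?C) \<inter> {f. f ` X = X}" by auto
  ultimately show ?thesis
    by (simp only: sspace_def mtopology_of_submetric subtopology_restrict)
qed

text \<open>
  The set \<open>U \<epsilon>\<close> is an interior within the space of surjections, so Baire's theorem needs only its density.
  A robust surjection, restricted to \<open>X\<close> so as to be a member of the space, lies in \<open>U \<epsilon>\<close>.
\<close>

theorem theorem4p1:
  fixes X :: "'a::metric_space set"
  assumes "graphite X"
  shows "\<exists>D. D \<subseteq> tset X \<and>
             gdelta_in (mtopology_of (sspace X)) D \<and>
             mtopology_of (sspace X) closure_of D = mspace (sspace X)"
proof -
  have X: "compact X" "graphoid X" using assms by (auto simp: graphite_def graphoid_def)
  have ne: "X \<noteq> {}"
  proof -
    obtain G r where G: "metric_graph G" "G \<subseteq> X"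
      by (rule graphoid_retraction[OF X(2) zero_less_one]) blast
    from G(1) obtain n :: nat and \<gamma> :: "nat \<Rightarrow> real \<Rightarrow> 'a" where "n > 0" "G = (\<Union>i<n. path_image (\<gamma> i))"
      unfolding metric_graph_def by (elim conjE exE)
    then have "path_image (\<gamma> 0) \<subseteq> X" using G(2) by blast
    then show ?thesis using path_image_nonempty[of "\<gamma> 0"] by blast
  qed
  let ?M = "sspace X"
  interpret M: Metric_space "mspace ?M" "mdist ?M" by (rule Metric_space_mspace_mdist)
  have top: "mtopology_of ?M = M.mtopology" by (simp add: mtopology_of_def)
  have MC: "f \<in> mspace (cspace X)" if "f \<in> mspace ?M" for f using that by (simp add: sspace_def)
  have less: "mdist ?M f h < r \<longleftrightarrow> (\<forall>x\<in>X. dist (f x) (h x) < r)" if "f \<in> mspace ?M" "h \<in> mspace ?M" for f h r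
    using mdist_cspace_less_iff[OF X(1) ne MC MC, OF that] by (simp add: sspace_def)
  define sh where "sh \<epsilon> h \<longleftrightarrow> (\<exists>\<delta>>0. \<forall>\<xi>. pseudo_orbit X h \<delta> \<xi> \<longrightarrow>
       (\<exists>z\<in>X. \<forall>i. dist (\<xi> i) ((h ^^ i) z) < \<epsilon>))" for \<epsilon> h
  define U where "U \<epsilon> = M.mtopology interior_of {h \<in> mspace ?M. sh \<epsilon> h}" for \<epsilon>
  define \<G> where "\<G> = range (\<lambda>n. U (inverse (Suc n)))"
  have dense: "M.mtopology closure_of (U \<epsilon>) = mspace ?M" if "\<epsilon> > 0" for \<epsilon>
  proof
    show "M.mtopology closure_of (U \<epsilon>) \<subseteq> mspace ?M" by (metis M.topspace_mtopology closure_of_subset_topspace)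
    show "mspace ?M \<subseteq> M.mtopology closure_of (U \<epsilon>)"
    proof
      fix g assume gM: "g \<in> mspace ?M"
      have "\<exists>f\<in>U \<epsilon>. f \<in> M.mball g \<eta>" if "\<eta> > 0" for \<eta>
      proof -
        have g: "continuous_on X g" "g ` X = X" using gM X(1) by (auto simp: mspace_sspace)
        obtain f where f: "continuous_on X f" "f ` X = X" "\<forall>x\<in>X. dist (f x) (g x) < \<eta>"
          and robust: "robust_shadowing X \<epsilon> f"
          using dense_robust_shadowing[OF assms g \<open>\<epsilon> > 0\<close> \<open>\<eta> > 0\<close>] by blast
        obtain \<rho> where \<rho>: "\<rho> > 0" "\<forall>h. continuous_on X h \<and> h ` X \<subseteq> X \<and> (\<forall>x\<in>X. dist (h x) (f x) < \<rho>) \<longrightarrow>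
            (\<forall>\<xi>. pseudo_orbit X h \<rho> \<xi> \<longrightarrow> (\<exists>z\<in>X. \<forall>n. dist (\<xi> n) ((h ^^ n) z) < \<epsilon>))"
          using robust unfolding robust_shadowing_def by (elim exE conjE)
        define f' where "f' = restrict f X"
        have f'M: "f' \<in> mspace ?M"
          using f(1,2) X(1) by (auto simp: mspace_sspace f'_def cong: continuous_on_cong)
        have "f' \<in> M.mball g \<eta>" using gM f'M f(3) less[OF gM f'M] by (simp add: f'_def dist_commute)
        moreover have "f' \<in> U \<epsilon>"
        proof -
          have "sh \<epsilon> h" if "h \<in> M.mball f' \<rho>" for h
          proof -
            have hM: "h \<in> mspace ?M" "mdist ?M f' h < \<rho>" using that by auto
            have "\<forall>x\<in>X. dist (h x) (f x) < \<rho>" using hM(2) less[OF f'M hM(1)] by (simp add: f'_def dist_commute)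
            moreover have "continuous_on X h" "h ` X \<subseteq> X" using hM(1) X(1) by (auto simp: mspace_sspace)
            ultimately have "\<forall>\<xi>. pseudo_orbit X h \<rho> \<xi> \<longrightarrow> (\<exists>z\<in>X. \<forall>n. dist (\<xi> n) ((h ^^ n) z) < \<epsilon>)"
              using \<rho>(2)[rule_format, of h] by blast
            then show ?thesis unfolding sh_def using \<rho>(1) by blast
          qed
          then have "M.mball f' \<rho> \<subseteq> {h \<in> mspace ?M. sh \<epsilon> h}" by auto
          then show ?thesis unfolding U_def interior_of_def using f'M \<rho>(1) by (auto intro!: exI[of _ "M.mball f' \<rho>"])
        qed
        ultimately show ?thesis by blast
      qed
      then show "g \<in> M.mtopology closure_of (U \<epsilon>)" using gM by (simp add: M.metric_closure_of)
    qed
  qed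
  have \<G>: "openin M.mtopology T \<and> M.mtopology closure_of T = mspace ?M" if "T \<in> \<G>" for T
    using that dense by (auto simp: \<G>_def U_def openin_interior_of)
  show ?thesis
  proof (intro exI[of _ "\<Inter>\<G>"] conjI)
    show "gdelta_in (mtopology_of ?M) (\<Inter>\<G>)" unfolding top
      by (rule gdelta_in_Inter) (use \<G> in \<open>auto simp: \<G>_def intro: open_imp_gdelta_in\<close>)
    show "mtopology_of ?M closure_of \<Inter>\<G> = mspace ?M"
      using Baire_category[OF disjI1[OF completely_metrizable_sspace[OF X(1) ne]], of \<G>] \<G>
      by (simp add: top \<G>_def)
    show "\<Inter>\<G> \<subseteq> tset X"
    proof
      fix f assume f: "f \<in> \<Inter>\<G>"
      have fU: "f \<in> mspace ?M \<and> sh (inverse (Suc n)) f" for n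
      proof -
        have "f \<in> U (inverse (Suc n))" using f by (auto simp: \<G>_def)
        then show ?thesis unfolding U_def using interior_of_subset by fastforce
      qed
      have "shadowing X f"
        unfolding shadowing_def
      proof (intro allI impI)
        fix \<epsilon> :: real assume "\<epsilon> > 0"
        then obtain n where n: "inverse (real (Suc n)) < \<epsilon>" using reals_Archimedean by blast
        have "sh (inverse (Suc n)) f" using fU by blast
        then show "\<exists>\<delta>>0. \<forall>x. pseudo_orbit X f \<delta> x \<longrightarrow> (\<exists>z\<in>X. \<forall>i. dist (x i) ((f ^^ i) z) < \<epsilon>)"
          unfolding sh_def using n by (meson order_less_trans)
      qed
      then show "f \<in> tset X" using fU MC by (auto simp: tset_def)
    qed
  qed
qed

end
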